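(* Let $p=2$, and let $\boldsymbol{X}_1,\dots,\boldsymbol{X}_n$ be i.i.d. random vectors in $\mathbb{R}^2$, $\boldsymbol{X}_i=(X_{i1},X_{i2})'$, with true joint density $g$ (marginal densities $g_1,g_2$). Fix $\beta\in(0,1]$. Suppose Assumptions A1–A5 below hold, that the best fitting parameter $\boldsymbol{\theta}^g=(\boldsymbol{\theta}^g_1,\boldsymbol{\theta}^g_2,\rho^g)$ lies in the open set $\gamma_0$ of A1, with $\rho^g\in(-1,1)$ and $\frac{\partial^2}{\partial\rho^2}H(\boldsymbol{\theta}^g_1,\boldsymbol{\theta}^g_2,\rho)\big|_{\rho=\rho^g}>0$, and that $\widehat{\boldsymbol{\theta}}_{1n},\widehat{\boldsymbol{\theta}}_{2n}$ are marginal minimum DPD estimators satisfying $\widehat{\boldsymbol{\theta}}_{jn}\to\boldsymbol{\theta}^g_j$ in probability, $j=1,2$. Then, with probability tending to $1$ as $n\to\infty$, the estimating equation $$\frac{\partial}{\partial\rho}H_n(\widehat{\boldsymbol{\theta}}_{1n},\widehat{\boldsymbol{\theta}}_{2n},\rho)=0$$ has a solution $\widehat{\rho}_n$ (a local minimizer of $\rho\mapsto H_n(\widehat{\boldsymbol{\theta}}_{1n},\widehat{\boldsymbol{\theta}}_{2n},\rho)$) such that $\widehat{\rho}_n\to\rho^g$ in probability.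
   Context: Model: a parametric family of bivariate densities $f(x_1,x_2,\boldsymbol{\theta}_1,\boldsymbol{\theta}_2,\rho)$ (e.g. bivariate marginals of an elliptically symmetric family) whose univariate marginals are $f_j(x,\boldsymbol{\theta}_j)$, where $\boldsymbol{\theta}_j=(\theta_{j1},\theta_{j2})=(\mu_j,\sigma_j^2)$, $\mu_j\in\mathbb{R}$, $\sigma_j^2>0$, and $\rho\in[-1,1]$ is the correlation. Put $\boldsymbol{\theta}=(\boldsymbol{\theta}_1,\boldsymbol{\theta}_2,\rho)$. For tuning parameter $\beta\in(0,1]$ define $V_j(x,\boldsymbol{\theta}_j)=\int f_j^{1+\beta}(t,\boldsymbol{\theta}_j)\,dt-(1+\tfrac1\beta)f_j^\beta(x,\boldsymbol{\theta}_j)$, $V(x_1,x_2,\boldsymbol{\theta}_1,\boldsymbol{\theta}_2,\rho)=\int f^{1+\beta}(u,v,\boldsymbol{\theta}_1,\boldsymbol{\theta}_2,\rho)\,du\,dv-(1+\tfrac1\beta)f^\beta(x_1,x_2,\boldsymbol{\theta}_1,\boldsymbol{\theta}_2,\rho)$, $H_{jn}(\boldsymbol{\theta}_j)=\frac1n\sum_i V_j(X_{ij},\boldsymbol{\theta}_j)$, $H_n(\boldsymbol{\theta}_1,\boldsymbol{\theta}_2,\rho)=\frac1n\sum_i V(X_{i1},X_{i2},\boldsymbol{\theta}_1,\boldsymbol{\theta}_2,\rho)$, $H_j(\boldsymbol{\theta}_j)=E_{g_j}V_j(X_{1j},\boldsymbol{\theta}_j)$, $H(\boldsymbol{\theta}_1,\boldsymbol{\theta}_2,\rho)=E_g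 V(X_{11},X_{12},\boldsymbol{\theta}_1,\boldsymbol{\theta}_2,\rho)$. The marginal estimators are $\widehat{\boldsymbol{\theta}}_{jn}=\arg\min H_{jn}$, and the best fitting parameters are $\boldsymbol{\theta}^g_j=\arg\min_{\boldsymbol{\theta}_j}H_j(\boldsymbol{\theta}_j)$, $\rho^g=\arg\min_{\rho\in[-1,1]}H(\boldsymbol{\theta}^g_1,\boldsymbol{\theta}^g_2,\rho)$. Let $U_\rho(x_1,x_2,\rho\mid\boldsymbol{\theta}_1,\boldsymbol{\theta}_2)=\partial_\rho\log f(x_1,x_2,\boldsymbol{\theta}_1,\boldsymbol{\theta}_2,\rho)$. "$L_1$ bounded" means integrable with respect to the true distribution. Assumptions: (A1) There is an open subset $\gamma_0$ of the parameter space such that for almost all $(x_1,x_2)$ and all $\boldsymbol{\theta}\in\gamma_0$ the densities $f_1,f_2,f$ are four times differentiable in $\boldsymbol{\theta}$ with fourth partial derivatives continuous in $\boldsymbol{\theta}$. (A2) The integrals $\int f_j^{1+\beta}(x,\boldsymbol{\theta}_j)dx$, $\int f^{1+\beta}\,dx_1dx_2$, $\int f_j^\beta(x,\boldsymbol{\theta}_j)g_j(x)dx$, $\int f^\beta g\,dx_1dx_2$ are four times differentiable in $\boldsymbol{\theta}$ and derivatives may be taken under the integral sign. (A3) For each $j$ and all indices $k_1,l_1,m_1$ there are $L_1$-bounded functions $M^j_{k_1l_1m_1}(x)$ with $|\nabla_{k_1l_1m_1}V_j(x,\boldsymbol{\theta}_j)|<M^j_{k_1l_1m_1}(x)$ for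 all $\boldsymbol{\theta}_j$ and $x$ (third order partial derivatives in $\boldsymbol{\theta}_j$). (A4) There exist $L_1$-bounded functions $M_{12}(x_1,x_2,\rho)$ (with finite Lebesgue integral) and $N_{12}(x_1,x_2,\rho)$ such that $|\partial_{\theta_{j_1k_1}}[f^{1+\beta}U_\rho]|<M_{12}$ and $|\partial_{\theta_{j_1k_1}}[f^{\beta}U_\rho]|<N_{12}$ for all $\boldsymbol{\theta}\in\gamma_0$, $\rho\in[-1,1]$, $(x_1,x_2)\in\mathbb{R}^2$ and $(j_1,k_1)\in\{(1,1),(1,2),(2,1),(2,2)\}$. (A5) There exist $L_1$-bounded functions $v_1(x_1,x_2,\boldsymbol{\theta}_1,\boldsymbol{\theta}_2)$, $v_2(x_1,x_2,\boldsymbol{\theta}_1,\boldsymbol{\theta}_2)$ with $|\partial^3_\rho V|<v_1$ and $|\partial^3_\rho\partial_{\theta_{j_1k_1}}V|<v_2$ for all $\boldsymbol{\theta}\in\gamma_0$, $\rho\in[-1,1]$, $(x_1,x_2)$ and $(j_1,k_1)$ as in A4. *)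

theory Defs
  imports "HOL-Probability.Probability"
begin

type_synonym mpar = "real \<times> real"            (* theta_j = (mu_j, sigma_j^2) *)
type_synonym fpar = "mpar \<times> mpar \<times> real"   (* theta = (theta_1, theta_2, rho) *)

definition PSm :: "mpar set" where
  "PSm = {t. 0 < snd t}"

definition PS :: "fpar set" where
  "PS = {th. fst th \<in> PSm \<and> fst (snd th) \<in> PSm \<and> snd (snd th) \<in> {-1..1}}"

definition e_rho :: fpar where
  "e_rho = ((0,0),(0,0),1)"

definition theta_dirs :: "fpar set" where
  "theta_dirs = Basis - {e_rho}"

fun pd :: "'p::euclidean_space list \<Rightarrow> ('p \<Rightarrow> real) \<Rightarrow> 'p \<Rightarrow> real" where
  "pd [] F = F"
| "pd (i # is) F = (\<lambda>th. deriv (\<lambda>t. pd is F (th + t *\<^sub>R i)) 0)"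

definition diff_upto :: "nat \<Rightarrow> ('p::euclidean_space \<Rightarrow> real) \<Rightarrow> 'p set \<Rightarrow> bool" where
  "diff_upto k F S \<longleftrightarrow>
     (\<forall>is. set is \<subseteq> Basis \<and> length is < k \<longrightarrow> (\<forall>th\<in>S. pd is F differentiable (at th)))"

definition C_upto :: "nat \<Rightarrow> ('p::euclidean_space \<Rightarrow> real) \<Rightarrow> 'p set \<Rightarrow> bool" where
  "C_upto k F S \<longleftrightarrow> diff_upto k F S \<and>
     (\<forall>is. set is \<subseteq> Basis \<and> length is = k \<longrightarrow> continuous_on S (pd is F))"

definition diff_under_int ::
  "nat \<Rightarrow> ('x \<Rightarrow> 'p::euclidean_space \<Rightarrow> real) \<Rightarrow> 'x measure \<Rightarrow> 'p set \<Rightarrow> bool" where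
  "diff_under_int k phi mu S \<longleftrightarrow> diff_upto k (\<lambda>th. LINT x|mu. phi x th) S \<and>
     (\<forall>is. set is \<subseteq> Basis \<and> length is \<le> k \<longrightarrow> (\<forall>th\<in>S.
        integrable mu (\<lambda>x. pd is (phi x) th) \<and>
        pd is (\<lambda>th. LINT x|mu. phi x th) th = (LINT x|mu. pd is (phi x) th)))"

definition upar :: "(real \<Rightarrow> real \<Rightarrow> mpar \<Rightarrow> mpar \<Rightarrow> real \<Rightarrow> real) \<Rightarrow> real \<Rightarrow> real \<Rightarrow> fpar \<Rightarrow> real" where
  "upar f x1 x2 th = f x1 x2 (fst th) (fst (snd th)) (snd (snd th))"

definition Vj :: "real \<Rightarrow> (real \<Rightarrow> mpar \<Rightarrow> real) \<Rightarrow> real \<Rightarrow> mpar \<Rightarrow> real" where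
  "Vj \<beta> fj x t = (LINT s|lborel. fj s t powr (1 + \<beta>)) - (1 + 1/\<beta>) * fj x t powr \<beta>"

definition V :: "real \<Rightarrow> (real \<Rightarrow> real \<Rightarrow> mpar \<Rightarrow> mpar \<Rightarrow> real \<Rightarrow> real)
                 \<Rightarrow> real \<Rightarrow> real \<Rightarrow> mpar \<Rightarrow> mpar \<Rightarrow> real \<Rightarrow> real" where
  "V \<beta> f x1 x2 t1 t2 r =
     (LINT u|lborel. f (fst u) (snd u) t1 t2 r powr (1 + \<beta>)) - (1 + 1/\<beta>) * f x1 x2 t1 t2 r powr \<beta>"

definition Hjn :: "real \<Rightarrow> (real \<Rightarrow> mpar \<Rightarrow> real) \<Rightarrow> (nat \<Rightarrow> real) \<Rightarrow> nat \<Rightarrow> mpar \<Rightarrow> real" where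
  "Hjn \<beta> fj xs n t = (\<Sum>i<n. Vj \<beta> fj (xs i) t) / real n"

definition Hn :: "real \<Rightarrow> (real \<Rightarrow> real \<Rightarrow> mpar \<Rightarrow> mpar \<Rightarrow> real \<Rightarrow> real) \<Rightarrow> (nat \<Rightarrow> real \<times> real)
                  \<Rightarrow> nat \<Rightarrow> mpar \<Rightarrow> mpar \<Rightarrow> real \<Rightarrow> real" where
  "Hn \<beta> f xs n t1 t2 r = (\<Sum>i<n. V \<beta> f (fst (xs i)) (snd (xs i)) t1 t2 r) / real n"

definition Urho :: "(real \<Rightarrow> real \<Rightarrow> mpar \<Rightarrow> mpar \<Rightarrow> real \<Rightarrow> real) \<Rightarrow> real \<Rightarrow> real \<Rightarrow> fpar \<Rightarrow> real" where
  "Urho f x1 x2 th = deriv (\<lambda>s. ln (f x1 x2 (fst th) (fst (snd th)) s)) (snd (snd th))"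

text \<open>Convergence in (outer) probability; for measurable Y this is ordinary convergence in
  probability.\<close>
definition conv_prob :: "'a measure \<Rightarrow> (nat \<Rightarrow> 'a \<Rightarrow> 'b::metric_space) \<Rightarrow> 'b \<Rightarrow> bool" where
  "conv_prob P Y c \<longleftrightarrow> (\<forall>\<epsilon>>0. \<forall>\<delta>>0. eventually (\<lambda>n. \<exists>A\<in>sets P.
      {\<omega>\<in>space P. \<epsilon> < dist (Y n \<omega>) c} \<subseteq> A \<and> measure P A < \<delta>) sequentially)"

end

theory Submission
  imports Defs
begin

text \<open>The density \<open>f\<close> is only assumed nonnegative, and where it vanishes \<open>\<partial>\<^sub>\<rho> f powr \<beta>\<close> may jump as the
  marginal parameters \<open>\<theta>\<close> vary, so the derivative of the objective at a fixed \<open>\<rho>\<close> need not converge.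
  Increments of the objective between two values of \<open>\<rho>\<close> do converge. Indeed
  \<open>f powr \<beta> * U\<close> is Lipschitz in \<open>\<theta>\<close> away from zeros of \<open>f\<close>, while \<open>f powr (1 + \<beta>) * U\<close> vanishes
  continuously at them, so (A4) bounds \<open>\<partial>\<^sub>\<rho> f powr \<beta>\<close> on \<open>f \<ge> 1\<close>, uniformly for \<open>\<theta>\<close> near \<open>\<theta>\<^sup>g\<close>, by a function
  \<open>K r\<close> integrable for each single \<open>r = \<rho>\<close>; on \<open>f \<le> 1\<close> the values \<open>f powr \<beta>\<close> are bounded. The expectation of \<open>K r\<close>
  need not be locally bounded in \<open>r\<close>, but by Baire's theorem it is bounded on a dense subset of some
  interval \<open>[a, b]\<close> arbitrarily close to \<open>\<rho>\<^sup>g\<close> on either side. Riemann sums with nodes in this subset and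
  Fatou's lemma then dominate the increment of \<open>f powr \<beta>\<close> over \<open>[a, b]\<close>, and a uniform weak law of large
  numbers applies to it.

  Since the limiting objective decreases to the left and increases to the right of \<open>\<rho>\<^sup>g\<close>, the empirical one
  increases over an interval to the right of \<open>\<rho>\<^sup>g\<close> and decreases over one to the left with probability
  tending to 1, which forces an interior local minimum in between.\<close>

section \<open>Real analysis\<close>

text \<open>\<open>\<Phi>\<close> is arbitrary, so a bound on a whole interval cannot be expected.
  The sublevel sets \<open>E C\<close> with \<open>C\<close> natural exhaust \<open>{p..q}\<close>;
  if no closure of one contained an interval, the complements of these closures would be dense and
  relatively open, and Baire's theorem would give a point outside every \<open>E C\<close>.\<close>

lemma dense_sublevel_on_subinterval:
  fixes \<Phi> :: "real \<Rightarrow> real"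
  assumes "p < q"
  obtains a b C where "p < a" "a < b" "b < q"
    "\<And>c d. a \<le> c \<Longrightarrow> c < d \<Longrightarrow> d \<le> b \<Longrightarrow> \<exists>r\<in>{c..d}. \<Phi> r \<le> C"
proof -
  define E where "E = (\<lambda>C::nat. {r\<in>{p..q}. \<Phi> r \<le> real C})"
  have "\<exists>C. \<exists>a b. p < a \<and> a < b \<and> b < q \<and> {a..b} \<subseteq> closure (E C)"
  proof (rule ccontr)
    assume neg: "\<not> ?thesis"
    let ?T = "\<lambda>C. {p..q} - closure (E C)"
    have dense: "{p..q} \<subseteq> closure (?T C)" for C
    proof (rule ccontr)
      assume "\<not> {p..q} \<subseteq> closure (?T C)"
      then obtain r where r: "r \<in> {p..q}" "r \<notin> closure (?T C)" by blast
      \<comment> \<open>\<open>r\<close> may be an endpoint of \<open>{p..q}\<close>; density of the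
        open interval moves it to a point \<open>s\<close> with room on both sides, so that the
        interval found lies strictly between \<open>p\<close> and \<open>q\<close>.\<close>
      have "r \<in> closure {p<..<q}" using r assms by (simp add: closure_greaterThanLessThan)
      moreover have op: "open (- closure (?T C))" by (intro open_Compl closed_closure)
      ultimately have "- closure (?T C) \<inter> {p<..<q} \<noteq> {}"
        using r(2) open_Int_closure_eq_empty[OF op, of "{p<..<q}"] by blast
      then obtain s where s: "s \<in> {p<..<q}" "s \<notin> closure (?T C)" by blast
      have "open ({p<..<q} \<inter> - closure (?T C))" by (intro open_Int open_Compl) auto
      moreover have "s \<in> {p<..<q} \<inter> - closure (?T C)" using s by auto
      ultimately obtain e where e: "e > 0" "cball s e \<subseteq> {p<..<q} \<inter> - closure (?T C)"
        using open_contains_cball by metis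
      have sub: "{s - e..s + e} \<subseteq> {p<..<q} \<inter> - closure (?T C)"
        using e(2) by (simp only: cball_eq_atLeastAtMost)
      have mem: "s - e \<in> {s - e..s + e}" "s + e \<in> {s - e..s + e}" using e(1) by simp_all
      have "p < s - e" "s + e < q" using subsetD[OF sub mem(1)] subsetD[OF sub mem(2)] by simp_all
      moreover have "{s-e..s+e} \<subseteq> closure (E C)"
      proof
        fix x assume "x \<in> {s-e..s+e}"
        from subsetD[OF sub this] have "x \<in> {p<..<q}" "x \<notin> ?T C"
          using closure_subset[of "?T C"] by blast+
        then show "x \<in> closure (E C)" by simp
      qed
      moreover have "s - e < s + e" using e(1) by simp
      ultimately show False using neg by blast
    qed
    have sub: "{p..q} \<subseteq> closure (\<Inter>(range ?T))"
    proof (rule Baire)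
      fix T assume "T \<in> range ?T"
      then obtain C where T: "T = ?T C" by blast
      have "openin (top_of_set {p..q}) ({p..q} \<inter> - closure (E C))"
        by (intro openin_open_Int open_Compl closed_closure)
      then show "openin (top_of_set {p..q}) T \<and> {p..q} \<subseteq> closure T"
        using dense[of C] by (simp only: T Diff_eq simp_thms)
    qed auto
    have "p \<in> closure (\<Inter>(range ?T))" by (rule subsetD[OF sub]) (use assms in simp)
    then have "\<Inter>(range ?T) \<noteq> {}" by (metis closure_empty empty_iff)
    then obtain r where "r \<in> \<Inter>(range ?T)" by (meson ex_in_conv)
    then have r: "r \<in> ?T C" for C by (rule INT_D) simp
    obtain C where "\<Phi> r \<le> real C" using real_arch_simple by blast
    then have "r \<in> E C" using r[of C] by (auto simp: E_def)
    then have "r \<in> closure (E C)" by (rule subsetD[OF closure_subset])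
    then show False using r[of C] by simp
  qed
  then obtain C a b where *: "p < a" "a < b" "b < q" "{a..b} \<subseteq> closure (E C)" by blast
  show thesis
  proof (rule that[OF *(1-3), of "real C"])
    fix c d assume cd: "a \<le> c" "c < d" "d \<le> b"
    \<comment> \<open>The midpoint is only a limit of points of \<open>E C\<close>, but the open
      interval around it must then contain such a point.\<close>
    have "(c + d) / 2 \<in> closure (E C)" using cd *(4) by auto
    moreover have "(c + d) / 2 \<in> {c<..<d}" using cd by auto
    ultimately have "{c<..<d} \<inter> E C \<noteq> {}"
      using open_Int_closure_eq_empty[OF open_greaterThanLessThan[of c d], of "E C"] by blast
    then obtain r where "r \<in> {c<..<d}" "r \<in> E C" by blast
    then show "\<exists>r\<in>{c..d}. \<Phi> r \<le> real C" by (intro bexI[of _ r]) (auto simp: E_def)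
  qed
qed

text \<open>The mean value theorem writes the increment over each cell as the width times a value of
  \<open>h\<close>, and uniform continuity moves that value to the tag. The tags are free within
  their cells, so they can later be taken from a merely dense set.\<close>

lemma increment_le_riemann_sum:
  fixes H h :: "real \<Rightarrow> real" and r :: "nat \<Rightarrow> nat \<Rightarrow> real"
  assumes ab: "a < b"
    and deriv: "\<And>x. x \<in> {a..b} \<Longrightarrow> (H has_real_derivative h x) (at x)"
    and cont: "continuous_on {a..b} h"
    and tags: "\<And>n k. k < n \<Longrightarrow> r n k \<in> {a + k * ((b - a) / n)..a + Suc k * ((b - a) / n)}"
    and e: "e > 0"
  shows "\<forall>\<^sub>F n in sequentially. \<bar>H b - H a\<bar> \<le> (b - a) / n * (\<Sum>k<n. \<bar>h (r n k)\<bar>) + e"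
proof -
  \<comment> \<open>The error per unit length: over the total length \<open>b - a\<close> it adds up
    to \<open>e\<close>.\<close>
  define e' where "e' = e / (b - a)"
  have e': "e' > 0" using e ab by (simp add: e'_def)
  have "uniformly_continuous_on {a..b} h"
    using cont by (intro compact_uniformly_continuous) auto
  then obtain d where d: "d > 0"
    "\<And>x y. x \<in> {a..b} \<Longrightarrow> y \<in> {a..b} \<Longrightarrow> dist y x < d \<Longrightarrow> dist (h y) (h x) < e'"
    unfolding uniformly_continuous_on_def using e' by metis
  obtain N :: nat where N: "(b - a) / d < N" using reals_Archimedean2 by blast
  show ?thesis
  proof (rule eventually_sequentiallyI[of "Suc N"])
    fix n assume "Suc N \<le> n"
    then have n: "n > 0" "(b - a) / d < real n" using N by linarith+
    define w where "w = (b - a) / n"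
    define y where "y = (\<lambda>k::nat. a + k * w)"
    have w: "0 < w" "w < d" using n ab d(1) by (auto simp: w_def field_simps)
    have nw: "n * w = b - a" using n by (simp add: w_def)
    have y0: "y 0 = a" and yn: "y n = b" using nw by (auto simp: y_def)
    have yS: "y (Suc k) = y k + w" for k by (simp add: y_def algebra_simps)
    have ran: "y k \<in> {a..b}" if "k \<le> n" for k
    proof -
      have "real k * w \<le> n * w" using that w by (intro mult_right_mono) auto
      then show ?thesis using w nw by (simp add: y_def)
    qed
    have step: "\<bar>H (y (Suc k)) - H (y k)\<bar> \<le> w * \<bar>h (r n k)\<bar> + w * e'" if k: "k < n" for k
    proof -
      have yk: "y k \<in> {a..b}" "y (Suc k) \<in> {a..b}" using ran k by auto
      have "\<exists>z. z > y k \<and> z < y (Suc k) \<and> H (y (Suc k)) - H (y k) = (y (Suc k) - y k) * h z"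
        by (rule MVT2) (use w yk deriv in \<open>auto simp: yS\<close>)
      then obtain z where z: "y k < z" "z < y (Suc k)" "H (y (Suc k)) - H (y k) = w * h z"
        by (auto simp: yS)
      have rr: "r n k \<in> {y k..y (Suc k)}" using tags[OF k] unfolding y_def w_def by simp
      have "dist (h z) (h (r n k)) < e'"
        using z rr yk w by (intro d(2)) (auto simp: dist_real_def yS)
      then have "\<bar>h z\<bar> \<le> \<bar>h (r n k)\<bar> + e'" by (simp add: dist_real_def)
      then have "w * \<bar>h z\<bar> \<le> w * (\<bar>h (r n k)\<bar> + e')" using w by (intro mult_left_mono) auto
      then show ?thesis using w by (simp add: z(3) abs_mult algebra_simps)
    qed
    have "H b - H a = (\<Sum>k<n. H (y (Suc k)) - H (y k))"
      using sum_lessThan_telescope[of "\<lambda>k. H (y k)" n] by (simp add: y0 yn)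
    also have "\<bar>\<dots>\<bar> \<le> (\<Sum>k<n. w * \<bar>h (r n k)\<bar> + w * e')"
      by (rule order_trans[OF sum_abs]) (use step in \<open>auto intro!: sum_mono\<close>)
    also have "\<dots> = w * (\<Sum>k<n. \<bar>h (r n k)\<bar>) + n * w * e'"
      by (simp add: sum.distrib sum_distrib_left)
    also have "n * w * e' = e" using ab by (simp add: nw e'_def)
    finally show "\<bar>H b - H a\<bar> \<le> (b - a) / n * (\<Sum>k<n. \<bar>h (r n k)\<bar>) + e" by (simp add: w_def)
  qed
qed

text \<open>A zero of \<open>F\<close> is a minimum of \<open>F\<close>, so at a local minimum of the difference the possibly
  cuspidal terms \<open>F i powr \<beta>\<close> with \<open>F i r0 = 0\<close> are squeezed between \<open>0\<close> and a differentiable function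
  whose derivative vanishes.\<close>
lemma has_derivative_0_at_local_min:
  fixes S :: "real \<Rightarrow> real" and F :: "'i \<Rightarrow> real \<Rightarrow> real"
  assumes fin: "finite I" and c: "c \<ge> 0" and d: "d > 0"
    and S: "S differentiable (at r0)"
    and F: "\<And>i. i \<in> I \<Longrightarrow> F i differentiable (at r0)" "\<And>i r. i \<in> I \<Longrightarrow> F i r \<ge> 0"
    and lmin: "\<And>r. \<bar>r - r0\<bar> < d \<Longrightarrow>
      S r0 - c * (\<Sum>i\<in>I. F i r0 powr \<beta>) \<le> S r - c * (\<Sum>i\<in>I. F i r powr \<beta>)"
  shows "((\<lambda>r. S r - c * (\<Sum>i\<in>I. F i r powr \<beta>)) has_real_derivative 0) (at r0)"
proof -
  define Z where "Z = {i\<in>I. F i r0 = 0}"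
  define q where "q = (\<lambda>r. c * (\<Sum>i\<in>Z. F i r powr \<beta>))"
  define T where "T = (\<lambda>r. S r - c * (\<Sum>i\<in>I - Z. F i r powr \<beta>))"
  have split: "S r - c * (\<Sum>i\<in>I. F i r powr \<beta>) = T r - q r" for r
  proof -
    have "(\<Sum>i\<in>I. F i r powr \<beta>) = (\<Sum>i\<in>I - Z. F i r powr \<beta>) + (\<Sum>i\<in>Z. F i r powr \<beta>)"
      using fin by (intro sum.subset_diff) (auto simp: Z_def)
    then show ?thesis by (simp add: T_def q_def algebra_simps)
  qed
  have q0: "q r0 = 0" by (auto simp: q_def Z_def)
  have qnn: "q r \<ge> 0" for r using c by (auto simp: q_def intro!: mult_nonneg_nonneg sum_nonneg)
  have TS: "T r0 + q r \<le> T r" if "\<bar>r - r0\<bar> < d" for r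
    using lmin[OF that] by (simp add: split q0)
  have "T differentiable (at r0)"
  proof -
    have "(\<lambda>r. F i r powr \<beta>) differentiable (at r0)" if i: "i \<in> I - Z" for i
    proof -
      have pos: "F i r0 > 0" using i F(2)[of i r0] by (auto simp: Z_def)
      obtain D where "(F i has_real_derivative D) (at r0)"
        using F(1)[of i] i by (auto simp: real_differentiable_def)
      from has_real_derivative_powr[OF pos] this
      have "((\<lambda>r. F i r powr \<beta>) has_real_derivative (\<beta> * F i r0 powr (\<beta> - 1)) * D) (at r0)"
        by (rule DERIV_chain2)
      then show ?thesis by (auto simp: real_differentiable_def)
    qed
    then show ?thesis unfolding T_def using S fin
      by (auto intro!: differentiable_diff differentiable_mult differentiable_sum)
  qed
  then obtain D where D: "(T has_real_derivative D) (at r0)" by (auto simp: real_differentiable_def)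
  \<comment> \<open>Discarding \<open>q r \<ge> 0\<close> makes \<open>r0\<close> a local minimum of
    \<open>T\<close> alone, which is differentiable there; hence \<open>T r - T r0\<close> is of
    smaller order than \<open>r - r0\<close> and can squeeze \<open>q\<close>.\<close>
  have "T r0 \<le> T r" if "\<bar>r0 - r\<bar> < d" for r
    using TS[of r] qnn[of r] that by linarith
  then have "D = 0" using DERIV_local_min[OF D d] by blast
  then have T0: "(T has_real_derivative 0) (at r0)" using D by simp
  have ev: "\<forall>\<^sub>F r in at r0. \<bar>r - r0\<bar> < d"
    using d by (auto simp: eventually_at dist_real_def)
  have "(q has_real_derivative 0) (at r0)"
    unfolding has_field_derivative_iff
  proof (rule Lim_null_comparison)
    show "((\<lambda>r. \<bar>(T r - T r0) / (r - r0)\<bar>) \<longlongrightarrow> 0) (at r0)"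
      using T0 unfolding has_field_derivative_iff by (rule tendsto_rabs_zero)
    show "\<forall>\<^sub>F r in at r0. norm ((q r - q r0) / (r - r0)) \<le> \<bar>(T r - T r0) / (r - r0)\<bar>"
      using ev
    proof eventually_elim
      case (elim r)
      then show ?case using TS[OF elim] qnn[of r] q0
        by (auto simp: abs_divide intro!: divide_right_mono)
    qed
  qed
  from DERIV_diff[OF T0 this] show ?thesis by (simp add: split)
qed

section \<open>Laws of large numbers and domination\<close>

lemma (in prob_space) prob_tendsto_1_Int:
  assumes "\<And>n. A n \<in> events" "\<And>n. B n \<in> events"
    and "(\<lambda>n. prob (A n)) \<longlonglongrightarrow> 1" "(\<lambda>n. prob (B n)) \<longlonglongrightarrow> 1"
  shows "(\<lambda>n. prob (A n \<inter> B n)) \<longlonglongrightarrow> 1"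
proof (rule tendsto_sandwich)
  have "prob (A n) + prob (B n) - 1 \<le> prob (A n \<inter> B n)" for n
    using measure_Un3[of "A n" M "B n"] prob_le_1[of "A n \<union> B n"] assms(1,2)[of n]
    by (simp add: fmeasurable_eq_sets)
  then show "\<forall>\<^sub>F n in sequentially. prob (A n) + prob (B n) - 1 \<le> prob (A n \<inter> B n)" by simp
  show "(\<lambda>n. prob (A n) + prob (B n) - 1) \<longlonglongrightarrow> 1"
    using tendsto_diff[OF tendsto_add[OF assms(3,4)] tendsto_const[of 1]] by simp
qed (auto intro: tendsto_const)

text \<open>Only a first moment is available, so no variance estimate applies to \<open>Y\<close>
  itself. Each variable is split at a level \<open>T\<close> into a bounded part, handled by
  Hoeffding's inequality, and a remainder of small mean modulus, handled by Markov's
  inequality.\<close>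

lemma (in prob_space) weak_law_of_large_numbers:
  fixes Y :: "nat \<Rightarrow> 'a \<Rightarrow> real"
  assumes indep: "indep_vars (\<lambda>_. borel) Y UNIV"
    and distr: "\<And>i. distr M borel (Y i) = distr M borel (Y 0)"
    and int: "integrable M (Y 0)" and e: "e > 0"
  shows "(\<lambda>n. prob {\<omega>\<in>space M. \<bar>(\<Sum>i<n. Y i \<omega>) / n - expectation (Y 0)\<bar> < e}) \<longlonglongrightarrow> 1"
proof -
  have meas[measurable]: "Y i \<in> borel_measurable M" for i
    using indep by (auto simp: indep_vars_def)
  have same_int: "integrable M (\<lambda>\<omega>. h (Y i \<omega>)) \<longleftrightarrow> integrable M (\<lambda>\<omega>. h (Y 0 \<omega>))"
    and same_exp: "expectation (\<lambda>\<omega>. h (Y i \<omega>)) = expectation (\<lambda>\<omega>. h (Y 0 \<omega>))"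
    if [measurable]: "h \<in> borel_measurable borel" for h :: "real \<Rightarrow> real" and i
    using distr[of i] integrable_distr_eq[of "Y i" M borel h] integrable_distr_eq[of "Y 0" M borel h]
      integral_distr[of "Y i" M borel h] integral_distr[of "Y 0" M borel h] by auto
  let ?bad = "\<lambda>n. {\<omega>\<in>space M. \<not> \<bar>(\<Sum>i<n. Y i \<omega>) / n - expectation (Y 0)\<bar> < e}"
  have "(\<lambda>n. prob (?bad n)) \<longlonglongrightarrow> 0"
  proof (rule LIMSEQ_I)
    fix d :: real assume d: "d > 0"
    let ?t = "\<lambda>T y. if \<bar>y\<bar> \<le> T then y else 0 :: real"
    let ?s = "\<lambda>T y. if \<bar>y\<bar> \<le> T then 0 else y :: real"
    have ints: "integrable M (\<lambda>\<omega>. \<bar>?s T (Y 0 \<omega>)\<bar>)" "integrable M (\<lambda>\<omega>. ?s T (Y 0 \<omega>))"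
      "integrable M (\<lambda>\<omega>. ?t T (Y 0 \<omega>))" for T
      by (rule Bochner_Integration.integrable_bound[OF int]; simp)+
    have "(\<lambda>k::nat. expectation (\<lambda>\<omega>. \<bar>?s (real k) (Y 0 \<omega>)\<bar>)) \<longlonglongrightarrow> expectation (\<lambda>_. 0)"
    proof (rule integral_dominated_convergence)
      show "integrable M (\<lambda>\<omega>. \<bar>Y 0 \<omega>\<bar>)" using int by simp
      show "AE \<omega> in M. (\<lambda>k. \<bar>?s (real k) (Y 0 \<omega>)\<bar>) \<longlonglongrightarrow> 0"
      proof (rule AE_I2)
        fix \<omega>
        obtain N :: nat where "\<bar>Y 0 \<omega>\<bar> \<le> N" using real_arch_simple by blast
        then have "\<forall>\<^sub>F k in sequentially. \<bar>?s (real k) (Y 0 \<omega>)\<bar> = 0"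
          by (intro eventually_sequentiallyI[of N]) auto
        then show "(\<lambda>k. \<bar>?s (real k) (Y 0 \<omega>)\<bar>) \<longlonglongrightarrow> 0" by (rule tendsto_eventually)
      qed
    qed auto
    then have "(\<lambda>k::nat. expectation (\<lambda>\<omega>. \<bar>?s (real k) (Y 0 \<omega>)\<bar>)) \<longlonglongrightarrow> 0" by simp
    from order_tendstoD(2)[OF this, of "min (e / 3) (e * d / 6)"] e d
    have "\<forall>\<^sub>F k::nat in sequentially.
        expectation (\<lambda>\<omega>. \<bar>?s (real k) (Y 0 \<omega>)\<bar>) < min (e / 3) (e * d / 6)" by simp
    then obtain N where N: "\<And>k::nat. N \<le> k \<Longrightarrow>
        expectation (\<lambda>\<omega>. \<bar>?s (real k) (Y 0 \<omega>)\<bar>) < min (e / 3) (e * d / 6)"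
      by (auto simp: eventually_sequentially)
    \<comment> \<open>\<open>Suc\<close> ensures \<open>T > 0\<close>, so the range of the truncated
      variables in Hoeffding's inequality is nondegenerate.\<close>
    define T where "T = real (Suc N)"
    have T: "T > 0" "expectation (\<lambda>\<omega>. \<bar>?s T (Y 0 \<omega>)\<bar>) < min (e / 3) (e * d / 6)"
      using N[of "Suc N"] by (auto simp: T_def)
    define \<mu> where "\<mu> = expectation (\<lambda>\<omega>. ?t T (Y 0 \<omega>))"
    have split_exp: "expectation (Y 0) = \<mu> + expectation (\<lambda>\<omega>. ?s T (Y 0 \<omega>))"
    proof -
      have "expectation (Y 0) = expectation (\<lambda>\<omega>. ?t T (Y 0 \<omega>) + ?s T (Y 0 \<omega>))"
        by (intro Bochner_Integration.integral_cong) auto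
      then show ?thesis using ints by (simp only: \<mu>_def Bochner_Integration.integral_add)
    qed
    have small_exp: "\<bar>expectation (\<lambda>\<omega>. ?s T (Y 0 \<omega>))\<bar> < e / 3"
      by (rule le_less_trans[OF integral_abs_bound]) (use T(2) in \<open>simp only: min_less_iff_conj\<close>)
    let ?A = "\<lambda>n. {\<omega>\<in>space M. \<bar>(\<Sum>i<n. ?t T (Y i \<omega>)) / n - \<mu>\<bar> \<ge> e / 3}"
    let ?B = "\<lambda>n. {\<omega>\<in>space M. (\<Sum>i<n. \<bar>?s T (Y i \<omega>)\<bar>) / n \<ge> e / 3}"
    have sub: "?bad n \<subseteq> ?A n \<union> ?B n" for n
    proof
      fix \<omega> assume \<omega>: "\<omega> \<in> ?bad n"
      have "(\<Sum>i<n. Y i \<omega>) = (\<Sum>i<n. ?t T (Y i \<omega>)) + (\<Sum>i<n. ?s T (Y i \<omega>))"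
        unfolding sum.distrib[symmetric] by (intro sum.cong) auto
      then have dec: "(\<Sum>i<n. Y i \<omega>) / n = (\<Sum>i<n. ?t T (Y i \<omega>)) / n + (\<Sum>i<n. ?s T (Y i \<omega>)) / n"
        by (simp add: add_divide_distrib)
      have tail: "\<bar>(\<Sum>i<n. ?s T (Y i \<omega>)) / n\<bar> \<le> (\<Sum>i<n. \<bar>?s T (Y i \<omega>)\<bar>) / n"
        by (simp only: abs_divide abs_of_nat) (intro divide_right_mono sum_abs, simp)
      have far: "\<not> \<bar>(\<Sum>i<n. Y i \<omega>) / n - (\<mu> + expectation (\<lambda>\<omega>. ?s T (Y 0 \<omega>)))\<bar> < e"
        using \<omega> split_exp by simp
      \<comment> \<open>The error splits in three: the bias stays below \<open>e / 3\<close>, so one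
        of the two random parts must reach \<open>e / 3\<close>.\<close>
      have aux: "\<bar>t - m\<bar> \<ge> e / 3 \<or> a \<ge> e / 3"
        if "x = t + s" "\<bar>s\<bar> \<le> a" "\<not> \<bar>x - (m + u)\<bar> < e" "\<bar>u\<bar> < e / 3" for x t s a m u :: real
        using that by linarith
      have "\<omega> \<in> space M" using \<omega> by simp
      then show "\<omega> \<in> ?A n \<union> ?B n"
        using aux[OF dec tail far small_exp] by (simp only: mem_Collect_eq Un_iff simp_thms)
    qed
    have B: "prob (?B n) \<le> d / 2" if n: "n > 0" for n
    proof -
      have i: "integrable M (\<lambda>\<omega>. \<bar>?s T (Y i \<omega>)\<bar>)"
        and eq: "expectation (\<lambda>\<omega>. \<bar>?s T (Y i \<omega>)\<bar>) = expectation (\<lambda>\<omega>. \<bar>?s T (Y 0 \<omega>)\<bar>)" for i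
        using same_int[of "\<lambda>y. \<bar>?s T y\<bar>" i] same_exp[of "\<lambda>y. \<bar>?s T y\<bar>" i] ints(1)[of T] by simp_all
      have "prob (?B n) \<le> expectation (\<lambda>\<omega>. (\<Sum>i<n. \<bar>?s T (Y i \<omega>)\<bar>) / n) / (e / 3)"
        by (rule integral_Markov_inequality_measure[where A="space M"])
          (use e i in \<open>auto intro!: divide_nonneg_nonneg sum_nonneg\<close>)
      also have "expectation (\<lambda>\<omega>. (\<Sum>i<n. \<bar>?s T (Y i \<omega>)\<bar>) / n) = (\<Sum>i<n. expectation (\<lambda>\<omega>. \<bar>?s T (Y i \<omega>)\<bar>)) / n"
        using i by (subst Bochner_Integration.integral_divide) (auto simp: Bochner_Integration.integral_sum)
      also have "(\<Sum>i<n. expectation (\<lambda>\<omega>. \<bar>?s T (Y i \<omega>)\<bar>)) = (\<Sum>i<n. expectation (\<lambda>\<omega>. \<bar>?s T (Y 0 \<omega>)\<bar>))"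
        by (rule sum.cong[OF refl]) (rule eq)
      also have "\<dots> / n = expectation (\<lambda>\<omega>. \<bar>?s T (Y 0 \<omega>)\<bar>)" using n by simp
      also have "\<dots> / (e / 3) \<le> (e * d / 6) / (e / 3)"
        using T(2) e by (intro divide_right_mono) auto
      also have "\<dots> = d / 2" using e by simp
      finally show ?thesis .
    qed
    have A: "prob (?A n) \<le> 2 * exp (-2 * n * (e / 3)\<^sup>2 / (T - (- T))\<^sup>2)" if n: "n > 0" for n
    proof -
      interpret H: Hoeffding_ineq_iid M "{..<n}" "\<lambda>i \<omega>. ?t T (Y i \<omega>)" "\<lambda>\<omega>. ?t T (Y 0 \<omega>)" "-T" T \<mu>
      proof unfold_locales
        show "indep_vars (\<lambda>_. borel) (\<lambda>i \<omega>. ?t T (Y i \<omega>)) {..<n}"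
          by (rule indep_vars_compose2[where M'="\<lambda>_. borel" and X=Y])
            (auto intro: indep_vars_subset[OF indep])
        show "distr M borel (\<lambda>\<omega>. ?t T (Y i \<omega>)) = distr M borel (\<lambda>\<omega>. ?t T (Y 0 \<omega>))" for i
          using distr_distr[of "?t T" borel borel "Y i" M] distr_distr[of "?t T" borel borel "Y 0" M]
            distr[of i] by (simp add: comp_def)
      qed (use T in \<open>auto simp: \<mu>_def\<close>)
      have "{..<n} \<noteq> {}" using n by (simp add: lessThan_empty_iff)
      then show ?thesis using H.Hoeffding_ineq_abs_ge'[of "e / 3"] e T(1) by simp
    qed
    have "(\<lambda>n. 2 * exp (-2 * real n * (e / 3)\<^sup>2 / (T - (- T))\<^sup>2)) \<longlonglongrightarrow> 0"
    proof -
      define c where "c = 2 * (e / 3)\<^sup>2 / (T - (- T))\<^sup>2"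
      have c: "c > 0" using e T(1) by (simp add: c_def)
      have "(\<lambda>n. 2 * exp (- c) ^ n) \<longlonglongrightarrow> 0"
        using c by (intro tendsto_mult_right_zero LIMSEQ_realpow_zero) auto
      moreover have "2 * exp (- c) ^ n = 2 * exp (-2 * real n * (e / 3)\<^sup>2 / (T - (- T))\<^sup>2)" for n
        by (simp add: exp_of_nat_mult[symmetric] c_def)
      ultimately show ?thesis by simp
    qed
    from order_tendstoD(2)[OF this, of "d / 2"] d
    have "\<forall>\<^sub>F n in sequentially. 2 * exp (-2 * real n * (e / 3)\<^sup>2 / (T - (- T))\<^sup>2) < d / 2" by simp
    then obtain n0 where n0: "\<And>n. n \<ge> n0 \<Longrightarrow> 2 * exp (-2 * real n * (e / 3)\<^sup>2 / (T - (- T))\<^sup>2) < d / 2"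
      by (auto simp: eventually_sequentially)
    show "\<exists>n0. \<forall>n\<ge>n0. norm (prob (?bad n) - 0) < d"
    proof (intro exI allI impI)
      fix n assume n: "n \<ge> Suc n0"
      have "prob (?bad n) \<le> prob (?A n \<union> ?B n)" by (intro finite_measure_mono sub) auto
      also have "\<dots> \<le> prob (?A n) + prob (?B n)" by (intro measure_Un_le) auto
      also have "\<dots> < d" using A[of n] B[of n] n0[of n] n by simp
      finally show "norm (prob (?bad n) - 0) < d" by simp
    qed
  qed
  then have "(\<lambda>n. 1 - prob (?bad n)) \<longlonglongrightarrow> 1 - 0" by (intro tendsto_diff tendsto_const)
  moreover have "1 - prob (?bad n) = prob {\<omega>\<in>space M. \<bar>(\<Sum>i<n. Y i \<omega>) / n - expectation (Y 0)\<bar> < e}" for n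
    by (subst prob_neg) auto
  ultimately show ?thesis by simp
qed

text \<open>The expectation of \<open>K r\<close> may be unbounded in \<open>r\<close>, so
  \<open>K\<close> is not integrated over an interval. Riemann sums of \<open>K\<close> are formed
  instead, with nodes at which the expectation is at most \<open>C\<close>, and their liminf is
  integrable by Fatou's lemma. The nodes do not depend on \<open>\<theta>\<close>, so one
  \<open>D\<close> serves all of \<open>T\<close>.\<close>

lemma (in prob_space) increments_dominated:
  fixes v h :: "'x \<Rightarrow> 'a \<Rightarrow> real \<Rightarrow> real" and K :: "real \<Rightarrow> 'a \<Rightarrow> real"
  assumes pq: "p < q"
    and K: "\<And>r. r \<in> {p..q} \<Longrightarrow> integrable M (K r)"
    and AE: "AE \<omega> in M. \<forall>\<theta>\<in>T. continuous_on {p..q} (h \<theta> \<omega>) \<and>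
      (\<forall>r\<in>{p..q}. (v \<theta> \<omega> has_real_derivative h \<theta> \<omega> r) (at r) \<and> \<bar>h \<theta> \<omega> r\<bar> \<le> K r \<omega>)"
    and ne: "T \<noteq> {}"
  obtains a b D where "p < a" "a < b" "b < q" "integrable M D"
    "AE \<omega> in M. \<forall>\<theta>\<in>T. \<bar>v \<theta> \<omega> b - v \<theta> \<omega> a\<bar> \<le> D \<omega>"
proof -
  obtain a b C where ab: "p < a" "a < b" "b < q" and
    dense: "\<And>c d. a \<le> c \<Longrightarrow> c < d \<Longrightarrow> d \<le> b \<Longrightarrow> \<exists>r\<in>{c..d}. expectation (K r) \<le> C"
    using dense_sublevel_on_subinterval[OF pq, of "\<lambda>r. expectation (K r)"] by blast
  define Tag where "Tag = (\<lambda>(n::nat) (k::nat) r. r \<in> {a + k * ((b - a) / n)..a + Suc k * ((b - a) / n)}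
      \<and> r \<in> {a..b} \<and> expectation (K r) \<le> C)"
  have ex: "\<exists>r. Tag n k r" if "k < n" for n k :: nat
  proof -
    have "real (Suc k) * ((b - a) / n) \<le> n * ((b - a) / n)"
      using that ab by (intro mult_right_mono) auto
    then have *: "a + Suc k * ((b - a) / n) \<le> b" using that by simp
    moreover have "a + k * ((b - a) / n) < a + Suc k * ((b - a) / n)"
      using that ab by (intro add_strict_left_mono mult_strict_right_mono) auto
    moreover have **: "a \<le> a + k * ((b - a) / n)" using ab by simp
    ultimately obtain r where r: "r \<in> {a + k * ((b - a) / n)..a + Suc k * ((b - a) / n)}"
      "expectation (K r) \<le> C"
      using dense[of "a + k * ((b - a) / n)" "a + Suc k * ((b - a) / n)"] by blast
    moreover have "r \<in> {a..b}" using r(1) * ** by (simp only: atLeastAtMost_iff) linarith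
    ultimately show ?thesis unfolding Tag_def by blast
  qed
  define t where "t = (\<lambda>n k. SOME r. Tag n k r)"
  have "Tag n k (t n k)" if "k < n" for n k :: nat
    unfolding t_def by (rule someI_ex[OF ex[OF that]])
  then have t: "t n k \<in> {a + k * ((b - a) / n)..a + Suc k * ((b - a) / n)}" "t n k \<in> {a..b}"
    "expectation (K (t n k)) \<le> C" if "k < n" for n k :: nat
    using that unfolding Tag_def by blast+
  have t_pq: "t n k \<in> {p..q}" if "k < n" for n k using t(2)[OF that] ab by auto
  define S where "S = (\<lambda>n \<omega>. (b - a) / n * (\<Sum>k<n. K (t n k) \<omega>))"
  have S_int: "integrable M (S n)" for n
    unfolding S_def by (intro integrable_mult_right Bochner_Integration.integrable_sum K t_pq) simp
  \<comment> \<open>\<open>\<bar>C\<bar>\<close> keeps the bound nonnegative, which covers the empty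
    sum at \<open>n = 0\<close>.\<close>
  have S_exp: "expectation (S n) \<le> (b - a) * \<bar>C\<bar>" for n
  proof -
    have "expectation (S n) = (b - a) / n * (\<Sum>k<n. expectation (K (t n k)))"
      unfolding S_def by (subst integral_mult_right_zero, subst Bochner_Integration.integral_sum)
        (auto intro!: K t_pq)
    also have "\<dots> \<le> (b - a) / n * (\<Sum>k<n. \<bar>C\<bar>)"
    proof (intro mult_left_mono sum_mono)
      fix k assume "k \<in> {..<n}"
      then show "expectation (K (t n k)) \<le> \<bar>C\<bar>" using t(3)[of k n] by simp
    qed (use ab in simp)
    also have "\<dots> \<le> (b - a) * \<bar>C\<bar>" using ab by simp
    finally show ?thesis .
  qed
  have K_nn: "AE \<omega> in M. \<forall>r\<in>{p..q}. 0 \<le> K r \<omega>"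
    using AE by eventually_elim (use ne in \<open>meson abs_ge_zero ex_in_conv order_trans\<close>)
  have S_nn: "AE \<omega> in M. 0 \<le> S n \<omega>" for n
    using K_nn
  proof eventually_elim
    case (elim \<omega>)
    then show ?case unfolding S_def using ab t_pq
      by (intro mult_nonneg_nonneg sum_nonneg) auto
  qed
  \<comment> \<open>The liminf is taken in \<open>ennreal\<close>, where it always exists; by
    Fatou's lemma it is finite almost everywhere, so \<open>enn2real\<close> preserves it
    there.\<close>
  define D' where "D' = (\<lambda>\<omega>. liminf (\<lambda>n. ennreal (S n \<omega>)))"
  have S_meas[measurable]: "S n \<in> borel_measurable M" for n using S_int by auto
  have D'_meas[measurable]: "D' \<in> borel_measurable M" unfolding D'_def by measurable
  have "(\<integral>\<^sup>+\<omega>. D' \<omega> \<partial>M) \<le> liminf (\<lambda>n. \<integral>\<^sup>+\<omega>. ennreal (S n \<omega>) \<partial>M)"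
    unfolding D'_def by (intro nn_integral_liminf) simp
  also have "\<dots> \<le> liminf (\<lambda>n. ennreal ((b - a) * \<bar>C\<bar>))"
  proof (intro Liminf_mono always_eventually allI)
    fix n
    have "(\<integral>\<^sup>+\<omega>. ennreal (S n \<omega>) \<partial>M) = ennreal (expectation (S n))"
      by (intro nn_integral_eq_integral S_int S_nn)
    then show "(\<integral>\<^sup>+\<omega>. ennreal (S n \<omega>) \<partial>M) \<le> ennreal ((b - a) * \<bar>C\<bar>)"
      using S_exp by (simp add: ennreal_leI)
  qed
  also have "\<dots> = ennreal ((b - a) * \<bar>C\<bar>)" by (simp add: Liminf_const)
  also have "\<dots> < \<infinity>" by simp
  finally have fin: "(\<integral>\<^sup>+\<omega>. D' \<omega> \<partial>M) < \<infinity>" .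
  then have D'_fin: "AE \<omega> in M. D' \<omega> \<noteq> \<infinity>"
    by (intro nn_integral_noteq_infinite) auto
  show thesis
  proof (rule that[OF ab])
    show "integrable M (\<lambda>\<omega>. enn2real (D' \<omega>))"
    proof (rule integrableI_nonneg)
      have "(\<integral>\<^sup>+\<omega>. ennreal (enn2real (D' \<omega>)) \<partial>M) \<le> (\<integral>\<^sup>+\<omega>. D' \<omega> \<partial>M)"
        by (intro nn_integral_mono) (simp add: ennreal_enn2real_if)
      then show "(\<integral>\<^sup>+\<omega>. ennreal (enn2real (D' \<omega>)) \<partial>M) < \<infinity>" using fin by (rule le_less_trans)
    qed auto
    show "AE \<omega> in M. \<forall>\<theta>\<in>T. \<bar>v \<theta> \<omega> b - v \<theta> \<omega> a\<bar> \<le> enn2real (D' \<omega>)"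
      using AE D'_fin
    proof eventually_elim
      case (elim \<omega>)
      show ?case
      proof
        fix \<theta> assume \<theta>: "\<theta> \<in> T"
        show "\<bar>v \<theta> \<omega> b - v \<theta> \<omega> a\<bar> \<le> enn2real (D' \<omega>)"
        \<comment> \<open>The index from which the Riemann sums are accurate up to \<open>e\<close>
          depends on \<open>\<theta>\<close> and \<open>\<omega>\<close>; for a liminf it is enough
          that each pair has such an index.\<close>
        proof (rule field_le_epsilon)
          fix e :: real assume e: "e > 0"
          have "\<forall>\<^sub>F n in sequentially.
              \<bar>v \<theta> \<omega> b - v \<theta> \<omega> a\<bar> \<le> (b - a) / n * (\<Sum>k<n. \<bar>h \<theta> \<omega> (t n k)\<bar>) + e"
            by (rule increment_le_riemann_sum[OF ab(2) _ _ t(1) e])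
              (use elim(1) \<theta> ab in \<open>auto intro: continuous_on_subset\<close>)
          then have "\<forall>\<^sub>F n in sequentially. ennreal (\<bar>v \<theta> \<omega> b - v \<theta> \<omega> a\<bar> - e) \<le> ennreal (S n \<omega>)"
          proof eventually_elim
            case (elim n)
            have "(\<Sum>k<n. \<bar>h \<theta> \<omega> (t n k)\<bar>) \<le> (\<Sum>k<n. K (t n k) \<omega>)"
              using \<open>\<forall>\<theta>\<in>T. continuous_on _ _ \<and> _\<close> \<theta> t_pq by (intro sum_mono) auto
            then have "(b - a) / n * (\<Sum>k<n. \<bar>h \<theta> \<omega> (t n k)\<bar>) \<le> S n \<omega>"
              unfolding S_def using ab by (intro mult_left_mono) auto
            then show ?case using elim by (intro ennreal_leI) simp
          qed
          then have "ennreal (\<bar>v \<theta> \<omega> b - v \<theta> \<omega> a\<bar> - e) \<le> D' \<omega>"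
            unfolding D'_def by (rule Liminf_bounded)
          then have "enn2real (ennreal (\<bar>v \<theta> \<omega> b - v \<theta> \<omega> a\<bar> - e)) \<le> enn2real (D' \<omega>)"
            using elim(2) by (intro enn2real_mono) (auto simp: top.not_eq_extremum)
          moreover have "\<bar>v \<theta> \<omega> b - v \<theta> \<omega> a\<bar> - e \<le> enn2real (ennreal (\<bar>v \<theta> \<omega> b - v \<theta> \<omega> a\<bar> - e))"
            by (cases "\<bar>v \<theta> \<omega> b - v \<theta> \<omega> a\<bar> - e \<ge> 0") (auto simp: not_le ennreal_neg)
          ultimately show "\<bar>v \<theta> \<omega> b - v \<theta> \<omega> a\<bar> \<le> enn2real (D' \<omega>) + e" by linarith
        qed
      qed
    qed
  qed
qed

text \<open>By continuity and dominated convergence, the oscillation of \<open>\<Delta>\<close> over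
  a shrinking ball around \<open>\<theta>0\<close> has expectation tending to 0. The weak law,
  applied to \<open>\<Delta> \<theta>0\<close> and to the oscillation \<open>W m\<close> for one
  fixed \<open>m\<close>, controls all \<open>\<theta>\<close> in the ball at once.\<close>

lemma (in prob_space) uniform_weak_law:
  fixes X :: "nat \<Rightarrow> 'a \<Rightarrow> 'b" and \<Delta> :: "'p::euclidean_space \<Rightarrow> 'b \<Rightarrow> real"
  assumes indep: "indep_vars (\<lambda>_. N) X UNIV"
    and distr: "\<And>i. distr M N (X i) = distr M N (X 0)"
    and d: "d > 0" and e: "e > 0"
    and meas: "\<And>\<theta>. \<theta> \<in> ball \<theta>0 d \<Longrightarrow> \<Delta> \<theta> \<in> borel_measurable N"
    and cont: "\<And>i. AE \<omega> in M. continuous_on (ball \<theta>0 d) (\<lambda>\<theta>. \<Delta> \<theta> (X i \<omega>))"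
    and dom: "AE \<omega> in M. \<forall>\<theta>\<in>ball \<theta>0 d. \<bar>\<Delta> \<theta> (X 0 \<omega>)\<bar> \<le> D \<omega>" and D: "integrable M D"
  obtains \<delta> E where "\<delta> > 0" "\<delta> \<le> d" "\<And>n. E n \<in> events" "(\<lambda>n. prob (E n)) \<longlonglongrightarrow> 1"
    "\<And>n \<omega> \<theta>. n > 0 \<Longrightarrow> \<omega> \<in> E n \<Longrightarrow> dist \<theta> \<theta>0 < \<delta> \<Longrightarrow>
      \<bar>(\<Sum>i<n. \<Delta> \<theta> (X i \<omega>)) / n - expectation (\<lambda>\<omega>. \<Delta> \<theta>0 (X 0 \<omega>))\<bar> < e"
proof -
  have X[measurable]: "X i \<in> measurable M N" for i using indep by (auto simp: indep_vars_def)
  \<comment> \<open>A supremum over countably many parameters is measurable; continuity in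
    \<open>\<theta>\<close> extends its bound from \<open>Q\<close> to the whole ball.\<close>
  obtain Q :: "'p set" where Q: "countable Q" "\<And>U. open U \<Longrightarrow> U \<noteq> {} \<Longrightarrow> \<exists>y\<in>Q. y \<in> U"
    by (rule countable_dense_setE) blast
  define B where "B = (\<lambda>m::nat. ball \<theta>0 (d / Suc m))"
  have Bd: "B m \<subseteq> ball \<theta>0 d" for m
    unfolding B_def using d by (intro subset_ball) (simp add: divide_le_eq)
  have B0: "\<theta>0 \<in> B m" for m using d by (simp add: B_def)
  define Z where "Z = (\<lambda>m x. SUP \<theta>\<in>Q \<inter> B m. ennreal \<bar>\<Delta> \<theta> x - \<Delta> \<theta>0 x\<bar>)"
  have meas0[measurable]: "\<Delta> \<theta>0 \<in> borel_measurable N" using meas[of \<theta>0] d by simp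
  have Z_meas[measurable]: "Z m \<in> borel_measurable N" for m
    unfolding Z_def
  proof (rule borel_measurable_SUP)
    fix \<theta> assume "\<theta> \<in> Q \<inter> B m"
    then have [measurable]: "\<Delta> \<theta> \<in> borel_measurable N" using Bd meas by blast
    show "(\<lambda>x. ennreal \<bar>\<Delta> \<theta> x - \<Delta> \<theta>0 x\<bar>) \<in> borel_measurable N" by measurable
  qed (use Q in simp)
  define W where "W = (\<lambda>m x. enn2real (Z m x))"
  have W_meas[measurable]: "W m \<in> borel_measurable N" for m unfolding W_def by measurable
  have W_nn: "W m x \<ge> 0" for m x by (simp add: W_def)
  have ZD: "AE \<omega> in M. \<forall>m. Z m (X 0 \<omega>) \<le> ennreal (2 * D \<omega>)"
    using dom
  proof eventually_elim
    case (elim \<omega>)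
    have "\<bar>\<Delta> \<theta> (X 0 \<omega>) - \<Delta> \<theta>0 (X 0 \<omega>)\<bar> \<le> 2 * D \<omega>" if "\<theta> \<in> ball \<theta>0 d" for \<theta>
    proof -
      have "\<bar>\<Delta> \<theta> (X 0 \<omega>)\<bar> \<le> D \<omega>" "\<bar>\<Delta> \<theta>0 (X 0 \<omega>)\<bar> \<le> D \<omega>" using elim that d by auto
      then show ?thesis by linarith
    qed
    then show ?case unfolding Z_def using Bd by (intro allI SUP_least ennreal_leI) blast
  qed
  have D_nn: "AE \<omega> in M. 0 \<le> D \<omega>"
    using dom by eventually_elim (meson abs_ge_zero centre_in_ball d order_trans)
  have WD: "AE \<omega> in M. \<forall>m. W m (X 0 \<omega>) \<le> 2 * D \<omega>"
    using ZD D_nn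
  proof eventually_elim
    case (elim \<omega>)
    show ?case
    proof
      fix m
      have "enn2real (Z m (X 0 \<omega>)) \<le> enn2real (ennreal (2 * D \<omega>))"
        using elim by (intro enn2real_mono) auto
      then show "W m (X 0 \<omega>) \<le> 2 * D \<omega>" using elim by (simp add: W_def)
    qed
  qed
  have W_int: "integrable M (\<lambda>\<omega>. W m (X 0 \<omega>))" for m
  proof (rule Bochner_Integration.integrable_bound)
    show "integrable M (\<lambda>\<omega>. 2 * D \<omega>)" using D by simp
    show "AE \<omega> in M. norm (W m (X 0 \<omega>)) \<le> norm (2 * D \<omega>)"
      using WD D_nn by eventually_elim (use W_nn in auto)
  qed simp
  have "(\<lambda>m. expectation (\<lambda>\<omega>. W m (X 0 \<omega>))) \<longlonglongrightarrow> expectation (\<lambda>_. 0)"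
  proof (rule integral_dominated_convergence[where w="\<lambda>\<omega>. 2 * D \<omega>"])
    show "AE \<omega> in M. (\<lambda>m. W m (X 0 \<omega>)) \<longlonglongrightarrow> 0"
      using cont[of 0]
    proof eventually_elim
      case (elim \<omega>)
      show ?case
      proof (rule LIMSEQ_I)
        fix r :: real assume r: "r > 0"
        have "isCont (\<lambda>\<theta>. \<Delta> \<theta> (X 0 \<omega>)) \<theta>0"
          using elim d by (auto simp: continuous_on_eq_continuous_at)
        then obtain s where s: "s > 0"
          "\<And>\<theta>. dist \<theta> \<theta>0 < s \<Longrightarrow> \<bar>\<Delta> \<theta> (X 0 \<omega>) - \<Delta> \<theta>0 (X 0 \<omega>)\<bar> < r / 2"
          unfolding continuous_at_eps_delta dist_real_def using r by (meson half_gt_zero)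
        obtain m0 :: nat where m0: "d / s < m0" using reals_Archimedean2 by blast
        show "\<exists>m0. \<forall>m\<ge>m0. norm (W m (X 0 \<omega>) - 0) < r"
        proof (intro exI allI impI)
          fix m assume "m \<ge> m0"
          then have "d / s < Suc m" using m0 by linarith
          then have "d / Suc m < s" using s(1) by (simp add: field_simps)
          then have "Z m (X 0 \<omega>) \<le> ennreal (r / 2)"
            unfolding Z_def using s(2)
            by (intro SUP_least ennreal_leI less_imp_le) (auto simp: B_def dist_commute)
          then have "W m (X 0 \<omega>) \<le> enn2real (ennreal (r / 2))"
            unfolding W_def by (intro enn2real_mono) auto
          then show "norm (W m (X 0 \<omega>) - 0) < r" using r W_nn[of m "X 0 \<omega>"] by simp
        qed
      qed
    qed
    show "AE \<omega> in M. norm (W m (X 0 \<omega>)) \<le> 2 * D \<omega>" for m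
      using WD by eventually_elim (use W_nn in auto)
  qed (use D in auto)
  then have "\<forall>\<^sub>F m in sequentially. expectation (\<lambda>\<omega>. W m (X 0 \<omega>)) < e / 4"
    using e by (intro order_tendstoD(2)) auto
  \<comment> \<open>The budget is \<open>e / 2\<close> for the sampling error of
    \<open>\<Delta> \<theta>0\<close>, \<open>e / 4\<close> for the expected oscillation and
    \<open>e / 4\<close> for the sampling error of the oscillation.\<close>
  then obtain m where m: "expectation (\<lambda>\<omega>. W m (X 0 \<omega>)) < e / 4"
    by (auto simp: eventually_sequentially)
  have \<Delta>_int: "integrable M (\<lambda>\<omega>. \<Delta> \<theta>0 (X 0 \<omega>))"
  proof (rule Bochner_Integration.integrable_bound[OF D])
    show "AE \<omega> in M. norm (\<Delta> \<theta>0 (X 0 \<omega>)) \<le> norm (D \<omega>)"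
      using dom
    proof eventually_elim
      case (elim \<omega>)
      then have "\<bar>\<Delta> \<theta>0 (X 0 \<omega>)\<bar> \<le> D \<omega>" using d by simp
      then show ?case by simp
    qed
  qed simp
  have same: "distr M borel (\<lambda>\<omega>. h (X i \<omega>)) = distr M borel (\<lambda>\<omega>. h (X 0 \<omega>))"
    if [measurable]: "h \<in> borel_measurable N" for h :: "'b \<Rightarrow> real" and i
    using distr_distr[of h N borel "X i" M] distr_distr[of h N borel "X 0" M] distr[of i]
    by (simp add: comp_def)
  have ind: "indep_vars (\<lambda>_. borel) (\<lambda>i \<omega>. h (X i \<omega>)) UNIV"
    if "h \<in> borel_measurable N" for h :: "'b \<Rightarrow> real"
    using that by (intro indep_vars_compose2[OF indep]) auto
  \<comment> \<open>\<open>enn2real\<close> sends infinity to 0, which would make \<open>W m\<close>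
    worthless as a bound, so finiteness is secured first. The domination concerns \<open>X 0\<close>
    only and reaches \<open>X i\<close> through the common law.\<close>
  have Z_fin: "AE \<omega> in M. Z m (X i \<omega>) \<noteq> \<infinity>" for i
  proof -
    have "AE \<omega> in M. Z m (X 0 \<omega>) \<noteq> \<infinity>"
      using ZD by eventually_elim (metis ennreal_less_top infinity_ennreal_def leD)
    then have "AE x in distr M N (X 0). Z m x \<noteq> \<infinity>"
      by (subst AE_distr_iff) auto
    then have "AE x in distr M N (X i). Z m x \<noteq> \<infinity>" by (simp only: distr[of i])
    then show ?thesis by (subst (asm) AE_distr_iff) auto
  qed
  have "AE \<omega> in M. \<forall>i. continuous_on (ball \<theta>0 d) (\<lambda>\<theta>. \<Delta> \<theta> (X i \<omega>)) \<and> Z m (X i \<omega>) \<noteq> \<infinity>"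
    using cont Z_fin by (simp add: AE_all_countable)
  then obtain G where G: "G \<in> events" "prob G = 1"
    "\<And>\<omega> i. \<omega> \<in> G \<Longrightarrow> continuous_on (ball \<theta>0 d) (\<lambda>\<theta>. \<Delta> \<theta> (X i \<omega>)) \<and> Z m (X i \<omega>) \<noteq> \<infinity>"
    by (rule AE_E_prob) auto
  define E1 where "E1 = (\<lambda>n. {\<omega>\<in>space M. \<bar>(\<Sum>i<n. \<Delta> \<theta>0 (X i \<omega>)) / n - expectation (\<lambda>\<omega>. \<Delta> \<theta>0 (X 0 \<omega>))\<bar> < e / 2})"
  define E2 where "E2 = (\<lambda>n. {\<omega>\<in>space M. \<bar>(\<Sum>i<n. W m (X i \<omega>)) / n - expectation (\<lambda>\<omega>. W m (X 0 \<omega>))\<bar> < e / 4})"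
  have ev: "E1 n \<in> events" "E2 n \<in> events" for n unfolding E1_def E2_def by measurable
  have E1: "(\<lambda>n. prob (E1 n)) \<longlonglongrightarrow> 1"
    unfolding E1_def by (rule weak_law_of_large_numbers[OF ind same]) (use \<Delta>_int e in auto)
  have E2: "(\<lambda>n. prob (E2 n)) \<longlonglongrightarrow> 1"
    unfolding E2_def by (rule weak_law_of_large_numbers[OF ind same]) (use W_int e in auto)
  show thesis
  proof (rule that[of "d / Suc m" "\<lambda>n. G \<inter> (E1 n \<inter> E2 n)"])
    show "(\<lambda>n. prob (G \<inter> (E1 n \<inter> E2 n))) \<longlonglongrightarrow> 1"
      using G ev E1 E2 by (intro prob_tendsto_1_Int sets.Int) auto
    show "d / Suc m \<le> d" using d by (simp add: divide_le_eq)
    fix n \<omega> \<theta> assume n: "n > (0::nat)" and \<omega>: "\<omega> \<in> G \<inter> (E1 n \<inter> E2 n)" and "dist \<theta> \<theta>0 < d / Suc m"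
    then have \<theta>: "\<theta> \<in> B m" by (simp add: B_def dist_commute)
    have le: "\<bar>\<Delta> \<theta> (X i \<omega>) - \<Delta> \<theta>0 (X i \<omega>)\<bar> \<le> W m (X i \<omega>)" for i
    proof (rule ccontr)
      assume neg: "\<not> ?thesis"
      have c: "continuous_on (B m) (\<lambda>\<theta>. \<bar>\<Delta> \<theta> (X i \<omega>) - \<Delta> \<theta>0 (X i \<omega>)\<bar>)"
        using G(3)[of \<omega> i] \<omega> Bd by (intro continuous_intros) (auto intro: continuous_on_subset)
      \<comment> \<open>A violating parameter would have an open set of violating neighbours, hence
        one in \<open>Q\<close>.\<close>
      let ?U = "(\<lambda>\<theta>. \<bar>\<Delta> \<theta> (X i \<omega>) - \<Delta> \<theta>0 (X i \<omega>)\<bar>) -` {W m (X i \<omega>)<..} \<inter> B m"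
      have "open ?U"
        using c continuous_on_open_vimage[of "B m"] open_greaterThan unfolding B_def by blast
      moreover have "\<theta> \<in> ?U" using neg \<theta> by simp
      ultimately obtain y where y: "y \<in> Q" "y \<in> ?U" using Q(2) by (metis empty_iff)
      have "ennreal \<bar>\<Delta> y (X i \<omega>) - \<Delta> \<theta>0 (X i \<omega>)\<bar> \<le> Z m (X i \<omega>)"
        unfolding Z_def using y by (intro SUP_upper) auto
      then have "enn2real (ennreal \<bar>\<Delta> y (X i \<omega>) - \<Delta> \<theta>0 (X i \<omega>)\<bar>) \<le> W m (X i \<omega>)"
        unfolding W_def using G(3)[of \<omega> i] \<omega> by (intro enn2real_mono) (auto simp: top.not_eq_extremum)
      then show False using y by simp
    qed
    have "(\<Sum>i<n. \<Delta> \<theta> (X i \<omega>)) / n - (\<Sum>i<n. \<Delta> \<theta>0 (X i \<omega>)) / n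
        = (\<Sum>i<n. \<Delta> \<theta> (X i \<omega>) - \<Delta> \<theta>0 (X i \<omega>)) / n"
      by (simp add: sum_subtractf diff_divide_distrib)
    also have "\<bar>\<dots>\<bar> \<le> (\<Sum>i<n. W m (X i \<omega>)) / n"
      by (simp only: abs_divide abs_of_nat)
        (intro divide_right_mono order_trans[OF sum_abs] sum_mono le, simp)
    finally have "\<bar>(\<Sum>i<n. \<Delta> \<theta> (X i \<omega>)) / n - (\<Sum>i<n. \<Delta> \<theta>0 (X i \<omega>)) / n\<bar>
        \<le> (\<Sum>i<n. W m (X i \<omega>)) / n" .
    moreover have "\<bar>(\<Sum>i<n. \<Delta> \<theta>0 (X i \<omega>)) / n - expectation (\<lambda>\<omega>. \<Delta> \<theta>0 (X 0 \<omega>))\<bar> < e / 2"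
      and "\<bar>(\<Sum>i<n. W m (X i \<omega>)) / n - expectation (\<lambda>\<omega>. W m (X 0 \<omega>))\<bar> < e / 4"
      using \<omega> by (simp_all only: E1_def E2_def Int_iff mem_Collect_eq)
    ultimately show "\<bar>(\<Sum>i<n. \<Delta> \<theta> (X i \<omega>)) / n - expectation (\<lambda>\<omega>. \<Delta> \<theta>0 (X 0 \<omega>))\<bar> < e"
      using m by linarith
  qed (use d G ev in auto)
qed

section \<open>Directional derivatives and the score\<close>

declare pd.simps(2) [simp del]

lemma continuous_on_of_differentiable_at:
  fixes F :: "'p::real_normed_vector \<Rightarrow> 'q::real_normed_vector"
  shows "(\<And>y. y \<in> S \<Longrightarrow> F differentiable (at y)) \<Longrightarrow> continuous_on S F"
  by (meson continuous_at_imp_continuous_on differentiable_imp_continuous_within)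

lemma has_derivative_pd:
  fixes K :: "'p::euclidean_space \<Rightarrow> real"
  assumes "K differentiable (at x)"
  shows "(K has_derivative (\<lambda>v. \<Sum>i\<in>Basis. (v \<bullet> i) * pd [i] K x)) (at x)"
proof -
  obtain D where D: "(K has_derivative D) (at x)" using assms by (auto simp: differentiable_def)
  interpret bounded_linear D using D by (rule has_derivative_bounded_linear)
  have pd_eq: "pd [i] K x = D i" for i
  proof -
    have "((\<lambda>t. x + t *\<^sub>R i) has_derivative (\<lambda>t. t *\<^sub>R i)) (at 0)"
      by (auto intro!: derivative_eq_intros)
    from has_derivative_compose[OF this, of K D] D
    have "((\<lambda>t. K (x + t *\<^sub>R i)) has_derivative (\<lambda>t. D (t *\<^sub>R i))) (at 0)" by simp
    then have "((\<lambda>t. K (x + t *\<^sub>R i)) has_real_derivative D i) (at 0)"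
      by (rule has_derivative_imp_has_field_derivative) (simp add: scaleR)
    then show ?thesis by (simp add: DERIV_imp_deriv pd.simps)
  qed
  have "D v = (\<Sum>i\<in>Basis. (v \<bullet> i) * pd [i] K x)" for v
  proof -
    have "D v = D (\<Sum>i\<in>Basis. (v \<bullet> i) *\<^sub>R i)" by (simp add: euclidean_representation)
    then show ?thesis by (simp add: sum scaleR pd_eq)
  qed
  then have "D = (\<lambda>v. \<Sum>i\<in>Basis. (v \<bullet> i) * pd [i] K x)" by (rule ext)
  then show ?thesis using D by (simp only:)
qed

text \<open>The mean value theorem along the segment. Differentiability is asked on the open range
  because the left end may be a zero of the density, and only directions with
  \<open>v \<bullet> i \<noteq> 0\<close> must be bounded, so that the \<rho> direction can be left
  out. Each coordinate of \<open>v\<close> is at most 1 in modulus, whence the factor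
  \<open>DIM('p)\<close>.\<close>

lemma segment_increment_le:
  fixes K :: "'p::euclidean_space \<Rightarrow> real" and N :: real
  assumes a: "0 \<le> a" "a < 1"
    and cont: "continuous_on {a..1} (\<lambda>s. K (x + s *\<^sub>R v))"
    and diff: "\<And>s. a < s \<Longrightarrow> s < 1 \<Longrightarrow> K differentiable (at (x + s *\<^sub>R v))"
    and bound: "\<And>s i. a < s \<Longrightarrow> s < 1 \<Longrightarrow> i \<in> Basis \<Longrightarrow> v \<bullet> i \<noteq> 0 \<Longrightarrow> \<bar>pd [i] K (x + s *\<^sub>R v)\<bar> \<le> N"
    and v: "norm v \<le> 1" and N: "0 \<le> N"
  shows "\<bar>K (x + v) - K (x + a *\<^sub>R v)\<bar> \<le> DIM('p) * N"
proof -
  let ?D = "\<lambda>s. \<Sum>i\<in>Basis. (v \<bullet> i) * pd [i] K (x + s *\<^sub>R v)"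
  have der: "((\<lambda>s. K (x + s *\<^sub>R v)) has_real_derivative ?D s) (at s)" if "a < s" "s < 1" for s
  proof -
    have "((\<lambda>s. x + s *\<^sub>R v) has_derivative (\<lambda>t. t *\<^sub>R v)) (at s)"
      by (auto intro!: derivative_eq_intros)
    from has_derivative_compose[OF this has_derivative_pd[OF diff[OF that]]]
    show ?thesis
      by (rule has_derivative_imp_has_field_derivative) (simp add: sum_distrib_left mult_ac)
  qed
  have sdiff: "(\<lambda>s. K (x + s *\<^sub>R v)) differentiable (at s)" if "a < s" "s < 1" for s
    using der[OF that] by (auto simp: real_differentiable_def)
  have "\<exists>l z. a < z \<and> z < 1 \<and> ((\<lambda>s. K (x + s *\<^sub>R v)) has_real_derivative l) (at z) \<and>
      K (x + 1 *\<^sub>R v) - K (x + a *\<^sub>R v) = (1 - a) * l"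
    by (rule MVT[OF a(2) cont]) (rule sdiff)
  then obtain l z where z: "a < z" "z < 1" "((\<lambda>s. K (x + s *\<^sub>R v)) has_real_derivative l) (at z)"
    "K (x + 1 *\<^sub>R v) - K (x + a *\<^sub>R v) = (1 - a) * l"
    by blast
  have "l = ?D z" using DERIV_unique[OF z(3) der[OF z(1,2)]] .
  have "\<bar>?D z\<bar> \<le> (\<Sum>i\<in>(Basis::'p set). N)"
  proof (rule order_trans[OF sum_abs], rule sum_mono)
    fix i :: 'p assume i: "i \<in> Basis"
    show "\<bar>(v \<bullet> i) * pd [i] K (x + z *\<^sub>R v)\<bar> \<le> N"
    proof (cases "v \<bullet> i = 0")
      case False
      have "\<bar>v \<bullet> i\<bar> * \<bar>pd [i] K (x + z *\<^sub>R v)\<bar> \<le> 1 * N"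
        using bound[OF z(1,2) i False] Basis_le_norm[OF i, of v] v N
        by (intro mult_mono) auto
      then show ?thesis by (simp add: abs_mult)
    qed (use N in simp)
  qed
  then have "\<bar>l\<bar> \<le> DIM('p) * N" using \<open>l = _\<close> by simp
  moreover have "(1 - a) * \<bar>l\<bar> \<le> 1 * \<bar>l\<bar>" using a by (intro mult_right_mono) auto
  ultimately show ?thesis using z(4) a by (simp add: abs_mult)
qed

text \<open>Where \<open>F\<close> has a zero on the segment, \<open>F powr \<beta> * q\<close> may jump and says nothing; but
  \<open>F powr (1 + \<beta>) * q = F powr \<beta> * pd [e] F\<close> vanishes continuously there, and dominates \<open>F powr \<beta> * q\<close>
  as soon as \<open>F\<close> is at least 1.\<close>
lemma score_bound_on_segment:
  fixes F q :: "'p::euclidean_space \<Rightarrow> real" and M N :: real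
  assumes S: "open S" and seg: "\<And>s. 0 \<le> s \<Longrightarrow> s \<le> 1 \<Longrightarrow> x + s *\<^sub>R v \<in> S"
    and v: "norm v \<le> 1" "v \<bullet> e = 0" and \<beta>: "\<beta> > 0"
    and F: "\<And>y. F y \<ge> 0" "\<And>y. y \<in> S \<Longrightarrow> F differentiable (at y)"
      "\<And>y. y \<in> S \<Longrightarrow> pd [e] F differentiable (at y)"
    and q: "\<And>y. y \<in> S \<Longrightarrow> F y > 0 \<Longrightarrow> q y = pd [e] F y / F y"
    and bound: "\<And>s i. 0 \<le> s \<Longrightarrow> s \<le> 1 \<Longrightarrow> i \<in> Basis - {e} \<Longrightarrow>
        \<bar>pd [i] (\<lambda>y. F y powr (1 + \<beta>) * q y) (x + s *\<^sub>R v)\<bar> \<le> M \<and>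
        \<bar>pd [i] (\<lambda>y. F y powr \<beta> * q y) (x + s *\<^sub>R v)\<bar> \<le> N"
    and MN: "M \<ge> 0" "N \<ge> 0"
    and F1: "F (x + v) \<ge> 1"
  shows "F (x + v) powr (\<beta> - 1) * \<bar>pd [e] F (x + v)\<bar>
    \<le> (if F x > 0 then F x powr (\<beta> - 1) * \<bar>pd [e] F x\<bar> else 0) + DIM('p) * (M + N)"
proof -
  have contF: "continuous_on S F" and contp: "continuous_on S (pd [e] F)"
    using F(2,3) by (auto intro: continuous_on_of_differentiable_at)
  have cseg: "continuous_on A (\<lambda>s. x + s *\<^sub>R v)" for A by (intro continuous_intros)
  have segS: "(\<lambda>s. x + s *\<^sub>R v) ` {a..1} \<subseteq> S" if "0 \<le> a" for a using seg that by auto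
  \<comment> \<open>On the open set \<open>U\<close> the function \<open>q\<close> is the score, so
    its products with powers of \<open>F\<close> are differentiable; at zeros of \<open>F\<close>
    nothing is known about \<open>q\<close>.\<close>
  define U where "U = {y\<in>S. F y > 0}"
  have "open U"
  proof -
    have "U = S \<inter> F -` {0<..}" by (auto simp: U_def)
    then show ?thesis
      using continuous_on_open_vimage[OF S, of F] contF by (metis Int_commute open_greaterThan)
  qed
  have qU: "F y powr c * q y = F y powr (c - 1) * pd [e] F y" if "y \<in> U" for y c
    using that q[of y] by (simp add: U_def powr_diff)
  have diffU: "(\<lambda>y. F y powr c * q y) differentiable (at y)" if y: "y \<in> U" for y c
  proof -
    have "F differentiable (at y)" "pd [e] F differentiable (at y)" "F y > 0"
      using y F by (auto simp: U_def)
    then obtain F' p' where F': "(F has_derivative F') (at y)" and p': "(pd [e] F has_derivative p') (at y)"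
      by (auto simp: differentiable_def)
    have "((\<lambda>y. F y powr (c - 1) * pd [e] F y) has_derivative
        (\<lambda>h. F y powr (c - 1) * p' h + (F y powr (c - 1) * (0 * ln (F y) + F' h * (c - 1) / F y)) * pd [e] F y)) (at y)"
      by (intro has_derivative_mult has_derivative_powr has_derivative_const F' p' \<open>F y > 0\<close>) auto
    then obtain D where "((\<lambda>y. F y powr (c - 1) * pd [e] F y) has_derivative D) (at y)" by blast
    then have "((\<lambda>y. F y powr c * q y) has_derivative D) (at y)"
      by (rule has_derivative_transform_within_open[OF _ \<open>open U\<close> y]) (simp add: qU)
    then show ?thesis by (auto simp: differentiable_def)
  qed
  have x1: "x + v \<in> U" using seg[of 1] F1 by (simp add: U_def)
  have dirs: "i \<in> Basis - {e}" if "i \<in> Basis" "v \<bullet> i \<noteq> 0" for i using that v(2) by auto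
  show ?thesis
  proof (cases "\<forall>s\<in>{0..1}. F (x + s *\<^sub>R v) > 0")
    case True
    then have inU: "x + s *\<^sub>R v \<in> U" if "0 \<le> s" "s \<le> 1" for s
      using seg that by (auto simp: U_def)
    have "continuous_on U (\<lambda>y. F y powr \<beta> * q y)"
      using diffU by (rule continuous_on_of_differentiable_at)
    then have "continuous_on {0..1} (\<lambda>s. F (x + s *\<^sub>R v) powr \<beta> * q (x + s *\<^sub>R v))"
      by (rule continuous_on_compose2[OF _ cseg]) (use inU in auto)
    from segment_increment_le[where K="\<lambda>y. F y powr \<beta> * q y", OF order_refl zero_less_one this _ _ v(1) MN(2)]
    have "\<bar>F (x + v) powr \<beta> * q (x + v) - F x powr \<beta> * q x\<bar> \<le> DIM('p) * N"
      using inU diffU bound dirs by simp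
    moreover have "x \<in> U" using inU[of 0] by simp
    ultimately have diff: "\<bar>F (x + v) powr (\<beta> - 1) * pd [e] F (x + v) - F x powr (\<beta> - 1) * pd [e] F x\<bar>
        \<le> DIM('p) * N" and pos: "F x > 0"
      using x1 by (simp_all add: qU U_def)
    have "\<bar>F (x + v) powr (\<beta> - 1) * pd [e] F (x + v)\<bar> \<le> \<bar>F x powr (\<beta> - 1) * pd [e] F x\<bar> + DIM('p) * N"
      using diff by linarith
    moreover have "DIM('p) * N \<le> DIM('p) * (M + N)" using MN by (intro mult_left_mono) auto
    ultimately have "\<bar>F (x + v) powr (\<beta> - 1) * pd [e] F (x + v)\<bar>
        \<le> \<bar>F x powr (\<beta> - 1) * pd [e] F x\<bar> + DIM('p) * (M + N)" by linarith
    then show ?thesis using pos by (simp add: abs_mult)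
  next
    case False
    define Z where "Z = {s\<in>{0..1}. F (x + s *\<^sub>R v) = 0}"
    have "Z \<noteq> {}"
    proof -
      obtain s where "s \<in> {0..1}" "\<not> F (x + s *\<^sub>R v) > 0" using False by blast
      then have "s \<in> Z" using F(1)[of "x + s *\<^sub>R v"] by (simp add: Z_def)
      then show ?thesis by blast
    qed
    have "continuous_on {0..1} (\<lambda>s. F (x + s *\<^sub>R v))"
      by (rule continuous_on_compose2[OF contF cseg segS]) simp
    then have "closedin (top_of_set {0..1}) Z"
      unfolding Z_def by (intro continuous_closedin_preimage_constant)
    then have "compact Z" by (rule closedin_compact[OF compact_Icc])
    \<comment> \<open>\<open>a\<close> marks the last zero on the segment: beyond it
      \<open>F\<close> is positive up to the end, and the increment is measured from
      \<open>a\<close>.\<close>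
    then obtain a where a: "a \<in> Z" "\<And>s. s \<in> Z \<Longrightarrow> s \<le> a"
      using compact_attains_sup[OF _ \<open>Z \<noteq> {}\<close>] by blast
    have a01: "0 \<le> a" "a < 1" "F (x + a *\<^sub>R v) = 0"
    proof -
      show "0 \<le> a" "F (x + a *\<^sub>R v) = 0" using a(1) by (auto simp: Z_def)
      moreover have "a \<noteq> 1" using calculation F1 by auto
      ultimately show "a < 1" using a(1) by (auto simp: Z_def)
    qed
    have inU: "x + s *\<^sub>R v \<in> U" if "a < s" "s \<le> 1" for s
    proof -
      have "s \<notin> Z" using a(2)[of s] that by auto
      then have "F (x + s *\<^sub>R v) \<noteq> 0" using that a01 by (simp add: Z_def)
      then show ?thesis using seg[of s] F(1)[of "x + s *\<^sub>R v"] that a01 by (simp add: U_def)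
    qed
    have "continuous_on {a..1} (\<lambda>s. F (x + s *\<^sub>R v) powr \<beta> * pd [e] F (x + s *\<^sub>R v))"
      using continuous_on_compose2[OF contF cseg segS[OF a01(1)]]
        continuous_on_compose2[OF contp cseg segS[OF a01(1)]] F(1) \<beta>
      by (intro continuous_on_mult continuous_on_powr' continuous_on_const) auto
    \<comment> \<open>At \<open>s = a\<close> both sides are 0 because \<open>0 powr c = 0\<close>,
      whatever the value of \<open>q\<close> there.\<close>
    moreover have "F (x + s *\<^sub>R v) powr \<beta> * pd [e] F (x + s *\<^sub>R v)
        = F (x + s *\<^sub>R v) powr (1 + \<beta>) * q (x + s *\<^sub>R v)" if "s \<in> {a..1}" for s
      using that inU[of s] a01 qU[of "x + s *\<^sub>R v" "1 + \<beta>"] by (cases "s = a") auto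
    ultimately have "continuous_on {a..1} (\<lambda>s. F (x + s *\<^sub>R v) powr (1 + \<beta>) * q (x + s *\<^sub>R v))"
      by (rule continuous_on_eq)
    from segment_increment_le[where K="\<lambda>y. F y powr (1 + \<beta>) * q y", OF a01(1,2) this _ _ v(1) MN(1)]
    have "\<bar>F (x + v) powr (1 + \<beta>) * q (x + v)\<bar> \<le> DIM('p) * M"
      using inU diffU bound dirs a01 by simp
    also have "F (x + v) powr (1 + \<beta>) * q (x + v) = F (x + v) * (F (x + v) powr (\<beta> - 1) * pd [e] F (x + v))"
      using x1 F1 qU[OF x1, of "1 + \<beta>"] by (simp add: powr_diff)
    finally have *: "F (x + v) * (F (x + v) powr (\<beta> - 1) * \<bar>pd [e] F (x + v)\<bar>) \<le> DIM('p) * M"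
      using F1 by (simp add: abs_mult)
    have "1 * (F (x + v) powr (\<beta> - 1) * \<bar>pd [e] F (x + v)\<bar>)
        \<le> F (x + v) * (F (x + v) powr (\<beta> - 1) * \<bar>pd [e] F (x + v)\<bar>)"
      using F1 by (intro mult_right_mono) auto
    also note *
    also have "DIM('p) * M \<le> DIM('p) * (M + N)" using MN by (intro mult_left_mono) auto
    finally show ?thesis by (simp add: add_increasing)
  qed
qed

text \<open>A \<open>C\<^sup>1\<close> function at bounded distance from \<open>y powr \<beta>\<close> that ignores the region \<open>y < 1\<close>.\<close>
definition tamed_powr :: "real \<Rightarrow> real \<Rightarrow> real" where
  "tamed_powr \<beta> y = (if 1 \<le> y then y powr \<beta> - 2 + y powr - \<beta> else 0)"

definition tamed_powr' :: "real \<Rightarrow> real \<Rightarrow> real" where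
  "tamed_powr' \<beta> y = (if 1 \<le> y then \<beta> * (y powr (\<beta> - 1) - y powr (- \<beta> - 1)) else 0)"

lemma tamed_powr_close:
  assumes "0 \<le> y" "0 < \<beta>"
  shows "\<bar>y powr \<beta> - tamed_powr \<beta> y\<bar> \<le> 2"
proof (cases "1 \<le> y")
  case True
  then have "y powr - \<beta> \<le> 1" using powr_mono[of "-\<beta>" 0 y] assms by simp
  then show ?thesis using True by (auto simp: tamed_powr_def abs_if)
next
  case False
  then have "y powr \<beta> \<le> 1" using assms powr_mono2[of \<beta> y 1] by simp
  then show ?thesis using False by (auto simp: tamed_powr_def)
qed

text \<open>For \<open>y \<ge> 1\<close> the formula is the square of
  \<open>y powr (\<beta> / 2) - y powr (- \<beta> / 2)\<close>, so value and slope vanish at 1 and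
  match those of the zero branch.\<close>

lemma tamed_powr_has_derivative:
  "(tamed_powr \<beta> has_real_derivative tamed_powr' \<beta> y) (at y)"
proof -
  have "((\<lambda>y. if y \<in> {1..} then y powr \<beta> - 2 + y powr - \<beta> else 0) has_vector_derivative
      (if y \<in> {1..} then \<beta> * (y powr (\<beta> - 1) - y powr (- \<beta> - 1)) else 0)) (at y within UNIV)"
  proof (rule has_vector_derivative_If_within_closures[where T="{..<1}"])
    assume "y \<in> {1..} \<union> (closure {1..} \<inter> closure {..<1})"
    then have "y > 0" by auto
    then have "((\<lambda>y. y powr \<beta> - 2 + y powr - \<beta>) has_real_derivative
       \<beta> * (y powr (\<beta> - 1) - y powr (- \<beta> - 1))) (at y)"
      by (auto intro!: derivative_eq_intros simp: powr_diff powr_minus field_simps)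
    then show "((\<lambda>y. y powr \<beta> - 2 + y powr - \<beta>) has_vector_derivative
       \<beta> * (y powr (\<beta> - 1) - y powr (- \<beta> - 1))) (at y within {1..} \<union> (closure {1..} \<inter> closure {..<1}))"
      by (simp add: has_real_derivative_iff_has_vector_derivative has_vector_derivative_at_within)
  qed auto
  then show ?thesis
    by (simp add: has_real_derivative_iff_has_vector_derivative tamed_powr_def[abs_def] tamed_powr'_def)
qed

lemma continuous_tamed_powr': "continuous_on UNIV (tamed_powr' \<beta>)"
proof -
  have "continuous_on ({1..} \<union> {..1}) (\<lambda>y. if 1 \<le> y then \<beta> * (y powr (\<beta> - 1) - y powr (- \<beta> - 1)) else 0)"
    by (intro continuous_on_If) (auto intro!: continuous_intros)
  moreover have "{1..} \<union> {..1} = (UNIV :: real set)" by auto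
  ultimately show ?thesis by (simp add: tamed_powr'_def[abs_def])
qed

lemma tamed_powr'_bound:
  assumes "0 < \<beta>" "\<beta> \<le> 1"
  shows "\<bar>tamed_powr' \<beta> y\<bar> \<le> (if 1 \<le> y then y powr (\<beta> - 1) else 0)"
proof (cases "1 \<le> y")
  case True
  have "y powr (- \<beta> - 1) \<le> y powr (\<beta> - 1)" using True assms by (intro powr_mono) auto
  then have "\<bar>y powr (\<beta> - 1) - y powr (- \<beta> - 1)\<bar> \<le> y powr (\<beta> - 1)" by simp
  from mult_mono[OF assms(2) this] show ?thesis using True assms by (simp add: tamed_powr'_def abs_mult)
qed (simp add: tamed_powr'_def)

section \<open>The density power divergence objective\<close>

lemma has_real_derivative_pd:
  fixes K :: "'p::euclidean_space \<Rightarrow> real"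
  assumes "K differentiable (at (x + s *\<^sub>R i))" and i: "i \<in> Basis"
  shows "((\<lambda>t. K (x + t *\<^sub>R i)) has_real_derivative pd [i] K (x + s *\<^sub>R i)) (at s)"
proof -
  have "((\<lambda>t. x + t *\<^sub>R i) has_derivative (\<lambda>t. t *\<^sub>R i)) (at s)"
    by (auto intro!: derivative_eq_intros)
  from has_derivative_compose[OF this has_derivative_pd[OF assms(1)]]
  show ?thesis
    by (rule has_derivative_imp_has_field_derivative)
      (simp add: inner_Basis i if_distrib[of "\<lambda>x. _ * x * _"] if_distrib[of "\<lambda>x. x * _"] cong: if_cong)
qed

section \<open>Coordinates separating \<rho> from the marginal parameters\<close>

text \<open>Triples in \<open>fpar\<close> are nested to the right, so the pair of marginal
  parameters is not a component; this regrouping lets neighbourhoods in \<open>\<theta>\<close> be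
  balls in \<open>mpar \<times> mpar\<close>. With last entry 0 it embeds increments of
  \<open>\<theta>\<close> orthogonally to \<open>e_rho\<close>.\<close>

definition with_rho :: "mpar \<times> mpar \<Rightarrow> real \<Rightarrow> fpar" where
  "with_rho \<theta> r = (fst \<theta>, snd \<theta>, r)"

lemma with_rho_simps [simp]:
  "fst (with_rho \<theta> r) = fst \<theta>" "fst (snd (with_rho \<theta> r)) = snd \<theta>" "snd (snd (with_rho \<theta> r)) = r"
  by (simp_all add: with_rho_def)

lemma with_rho_add: "with_rho \<theta> r + s *\<^sub>R with_rho v 0 = with_rho (\<theta> + s *\<^sub>R v) r"
  by (simp add: with_rho_def prod_eq_iff)

lemma with_rho_line: "with_rho \<theta> r = with_rho \<theta> 0 + r *\<^sub>R e_rho"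
  by (simp add: with_rho_def e_rho_def prod_eq_iff)

lemma with_rho_add_e_rho: "with_rho \<theta> r + s *\<^sub>R e_rho = with_rho \<theta> (s + r)"
  by (simp add: with_rho_def e_rho_def prod_eq_iff)

lemma norm_with_rho_0: "norm (with_rho v 0) = norm v"
  by (simp add: with_rho_def norm_prod_def)

lemma with_rho_inner_e_rho: "with_rho v 0 \<bullet> e_rho = 0"
  by (simp add: with_rho_def e_rho_def zero_prod_def[symmetric])

lemma e_rho_Basis: "e_rho \<in> Basis"
  by (simp add: e_rho_def Basis_prod_def zero_prod_def[symmetric])

lemma theta_dirs_nonempty: "((1, 0), (0, 0), 0) \<in> theta_dirs"
  by (auto simp: theta_dirs_def e_rho_def Basis_prod_def zero_prod_def)

lemma continuous_on_with_rho:
  "continuous_on A (\<lambda>\<theta>. with_rho \<theta> r)" "continuous_on B (\<lambda>r. with_rho \<theta> r)"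
  by (auto simp: with_rho_def intro!: continuous_intros)

lemma has_real_derivative_pd_rho:
  fixes K :: "fpar \<Rightarrow> real"
  assumes "K differentiable (at (with_rho \<theta> r))"
  shows "((\<lambda>r. K (with_rho \<theta> r)) has_real_derivative pd [e_rho] K (with_rho \<theta> r)) (at r)"
proof -
  have "K differentiable (at (with_rho \<theta> 0 + r *\<^sub>R e_rho))"
    using assms by (subst with_rho_line[symmetric])
  from has_real_derivative_pd[OF this e_rho_Basis] show ?thesis
    by (simp only: with_rho_line[symmetric])
qed

text \<open>At a zero of the density \<open>ln\<close> takes a default value and \<open>Urho\<close>
  need not be a score, hence the restriction to positive values.\<close>

lemma Urho_eq:
  assumes "upar f x1 x2 differentiable (at th)" "upar f x1 x2 th > 0"
  shows "Urho f x1 x2 th = pd [e_rho] (upar f x1 x2) th / upar f x1 x2 th"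
proof -
  define \<theta> where "\<theta> = (fst th, fst (snd th))"
  define r where "r = snd (snd th)"
  have th: "th = with_rho \<theta> r" by (simp add: \<theta>_def r_def with_rho_def)
  have "((\<lambda>r. ln (upar f x1 x2 (with_rho \<theta> r))) has_real_derivative
      1 / upar f x1 x2 th * pd [e_rho] (upar f x1 x2) th) (at r)"
    unfolding th by (rule DERIV_chain2[OF DERIV_ln_divide has_real_derivative_pd_rho]) (use assms th in simp_all)
  then have "deriv (\<lambda>r. ln (upar f x1 x2 (with_rho \<theta> r))) r
      = 1 / upar f x1 x2 th * pd [e_rho] (upar f x1 x2) th" by (rule DERIV_imp_deriv)
  then show ?thesis by (simp add: Urho_def upar_def[abs_def] \<theta>_def r_def with_rho_def)
qed

section \<open>The sampling model and a dominating function for the \<rho> derivative\<close>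

text \<open>\<open>M\<close> and \<open>N\<close> are integrable for one \<rho> at a time, with no
  bound uniform in \<rho>; this is the form in which (A4) provides them.\<close>

locale dpd_sample = prob_space P for P :: "'a measure" +
  fixes X :: "nat \<Rightarrow> 'a \<Rightarrow> real \<times> real" and g :: "real \<times> real \<Rightarrow> real"
    and f :: "real \<Rightarrow> real \<Rightarrow> mpar \<Rightarrow> mpar \<Rightarrow> real \<Rightarrow> real" and \<beta> :: real and S :: "fpar set"
    and M N :: "real \<times> real \<Rightarrow> real \<Rightarrow> real"
  assumes indep: "indep_vars (\<lambda>_. borel) X UNIV"
    and g_nonneg: "\<And>u. 0 \<le> g u"
    and distX: "\<And>i. distributed P lborel (X i) (\<lambda>u. ennreal (g u))"
    and f_nonneg: "\<And>x1 x2 t1 t2 r. 0 \<le> f x1 x2 t1 t2 r"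
    and beta: "0 < \<beta>" "\<beta> \<le> 1"
    and open_S: "open S"
    and f_meas: "\<And>th. th \<in> S \<Longrightarrow> (\<lambda>u. upar f (fst u) (snd u) th) \<in> borel_measurable borel"
    and smooth: "AE u in lborel. diff_upto 2 (upar f (fst u) (snd u)) S"
    and I_diff: "diff_upto 2 (\<lambda>th. LINT u|lborel. upar f (fst u) (snd u) th powr (1 + \<beta>)) S"
    and J_diff: "diff_upto 2 (\<lambda>th. LINT u|lborel. upar f (fst u) (snd u) th powr \<beta> * g u) S"
    and J_int: "\<And>is th. set is \<subseteq> Basis \<Longrightarrow> length is \<le> 1 \<Longrightarrow> th \<in> S \<Longrightarrow>
        integrable lborel (\<lambda>u. pd is (\<lambda>th. upar f (fst u) (snd u) th powr \<beta> * g u) th)"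
    and MN_int: "\<And>r. integrable P (\<lambda>\<omega>. M (X 0 \<omega>) r)" "\<And>r. integrable P (\<lambda>\<omega>. N (X 0 \<omega>) r)"
    and MN: "\<And>u th e. th \<in> S \<Longrightarrow> e \<in> theta_dirs \<Longrightarrow>
        \<bar>pd [e] (\<lambda>th. upar f (fst u) (snd u) th powr (1 + \<beta>) * Urho f (fst u) (snd u) th) th\<bar> \<le> M u (snd (snd th)) \<and>
        \<bar>pd [e] (\<lambda>th. upar f (fst u) (snd u) th powr \<beta> * Urho f (fst u) (snd u) th) th\<bar> \<le> N u (snd (snd th))"
begin

abbreviation F :: "real \<times> real \<Rightarrow> fpar \<Rightarrow> real" where
  "F u \<equiv> upar f (fst u) (snd u)"

abbreviation I :: "fpar \<Rightarrow> real" where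
  "I \<equiv> \<lambda>th. LINT u|lborel. F u th powr (1 + \<beta>)"

abbreviation J :: "fpar \<Rightarrow> real" where
  "J \<equiv> \<lambda>th. LINT u|lborel. F u th powr \<beta> * g u"

lemma F_nonneg: "F u th \<ge> 0" using f_nonneg by (simp add: upar_def)

lemma g_meas [measurable]: "g \<in> borel_measurable borel"
  using distributed_real_measurable[of lborel g P "X 0"] g_nonneg distX[of 0] by simp

lemma X_meas [measurable]: "X i \<in> measurable P borel"
  using distributed_measurable[OF distX[of i]] by simp

lemma distr_X: "distr P borel (X i) = density lborel (\<lambda>u. ennreal (g u))"
  using distributed_distr_eq_density[OF distX[of i]] by (simp cong: distr_cong)

lemma AE_X:
  assumes "AE u in lborel. Q u"
  shows "AE \<omega> in P. Q (X i \<omega>)"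
proof -
  have "AE u in distr P borel (X i). Q u"
    unfolding distr_X using assms by (subst AE_density) auto
  then show ?thesis by (rule AE_distrD[OF X_meas])
qed

text \<open>The law of \<open>X 0\<close> has density \<open>g\<close> and gives no mass to the
  zeros of \<open>g\<close>; this makes the division by \<open>g\<close> in \<open>K\<close>
  legitimate.\<close>

lemma AE_g_pos: "AE \<omega> in P. g (X 0 \<omega>) > 0"
proof -
  have "AE u in distr P borel (X 0). g u > 0"
    unfolding distr_X by (subst AE_density) auto
  then show ?thesis by (rule AE_distrD[OF X_meas])
qed

lemma diff_upto_2D:
  assumes "diff_upto 2 K S" "th \<in> S"
  shows "K differentiable (at th)" "pd [e_rho] K differentiable (at th)"
proof -
  have "pd [] K differentiable (at th)"
    using assms unfolding diff_upto_def by (metis empty_subsetI list.set(1) list.size(3) zero_less_numeral)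
  then show "K differentiable (at th)" by simp
  have "set [e_rho] \<subseteq> Basis" "length [e_rho] < 2" using e_rho_Basis by auto
  then show "pd [e_rho] K differentiable (at th)"
    using assms unfolding diff_upto_def by blast
qed

text \<open>(A2) gives integrability only for the derivative of \<open>f powr \<beta>\<close> weighted by \<open>g\<close>, whence the division
  by \<open>g\<close>; where \<open>f powr \<beta>\<close> is not differentiable the first summand is a junk value that is harmless.\<close>
definition K :: "mpar \<times> mpar \<Rightarrow> real \<Rightarrow> 'a \<Rightarrow> real" where
  "K \<theta> r \<omega> = \<bar>pd [e_rho] (\<lambda>th. F (X 0 \<omega>) th powr \<beta> * g (X 0 \<omega>)) (with_rho \<theta> r)\<bar> / (\<beta> * g (X 0 \<omega>))
    + 5 * (M (X 0 \<omega>) r + N (X 0 \<omega>) r)"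

text \<open>Integrating against the law of \<open>X 0\<close> multiplies by \<open>g\<close> and
  cancels the division; where \<open>g u = 0\<close> the product is 0 and the comparison still
  holds.\<close>

lemma K_integrable:
  assumes "with_rho \<theta> r \<in> S"
  shows "integrable P (K \<theta> r)"
proof -
  let ?p = "\<lambda>u. pd [e_rho] (\<lambda>th. F u th powr \<beta> * g u) (with_rho \<theta> r)"
  have p: "integrable lborel ?p" using J_int[of "[e_rho]"] e_rho_Basis assms by simp
  then have p_meas[measurable]: "?p \<in> borel_measurable borel" by (simp add: borel_measurable_integrable[of lborel, simplified])
  have "integrable lborel (\<lambda>u. g u * (\<bar>?p u\<bar> / (\<beta> * g u)))"
  proof (rule Bochner_Integration.integrable_bound)
    show "integrable lborel (\<lambda>u. ?p u / \<beta>)" using p by simp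
    show "AE u in lborel. norm (g u * (\<bar>?p u\<bar> / (\<beta> * g u))) \<le> norm (?p u / \<beta>)"
      using beta by (auto simp: abs_mult)
  qed simp
  then have "integrable P (\<lambda>\<omega>. \<bar>?p (X 0 \<omega>)\<bar> / (\<beta> * g (X 0 \<omega>)))"
    using distributed_integrable[OF distX[of 0], of "\<lambda>u. \<bar>?p u\<bar> / (\<beta> * g u)"] g_nonneg by simp
  then show ?thesis
    unfolding K_def[abs_def] using MN_int by (intro Bochner_Integration.integrable_add integrable_mult_right) auto
qed

lemma pd_weighted_powr:
  assumes "F u differentiable (at (with_rho \<theta> r))" "F u (with_rho \<theta> r) > 0"
  shows "pd [e_rho] (\<lambda>th. F u th powr \<beta> * g u) (with_rho \<theta> r)
    = \<beta> * g u * (F u (with_rho \<theta> r) powr (\<beta> - 1) * pd [e_rho] (F u) (with_rho \<theta> r))"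
proof -
  let ?h = "\<lambda>r. F u (with_rho \<theta> r) powr \<beta> * g u"
  let ?D = "(\<beta> * F u (with_rho \<theta> r) powr (\<beta> - 1)) * pd [e_rho] (F u) (with_rho \<theta> r) * g u"
  have "(?h has_real_derivative ?D) (at r)"
    by (intro DERIV_cmult_right DERIV_chain2[OF has_real_derivative_powr has_real_derivative_pd_rho] assms)
  then have "((\<lambda>t. ?h (t + r)) has_real_derivative ?D) (at 0)"
    using DERIV_shift[of ?h ?D 0 r] by simp
  then have "deriv (\<lambda>t. ?h (t + r)) 0 = ?D" by (rule DERIV_imp_deriv)
  then show ?thesis by (simp add: pd.simps with_rho_add_e_rho mult_ac)
qed

text \<open>These are the conditions of \<open>increments_dominated\<close> for the tamed power.
  Where \<open>F < 1\<close> its derivative is 0; elsewhere the derivative is compared, along the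
  segment from \<open>\<theta>0\<close> to \<open>\<theta>\<close> at fixed \<open>r\<close>, with
  the one at the base point, which \<open>K \<theta>0 r\<close> contains together with the (A4)
  bounds.\<close>

lemma tamed_increment_bound:
  assumes d: "0 < d" "d \<le> 1"
    and box: "\<And>\<theta> r. \<theta> \<in> ball \<theta>0 d \<Longrightarrow> r \<in> {p..q} \<Longrightarrow> with_rho \<theta> r \<in> S"
    and F: "diff_upto 2 (F (X 0 \<omega>)) S" and g: "g (X 0 \<omega>) > 0"
    and \<theta>: "\<theta> \<in> ball \<theta>0 d"
  shows "continuous_on {p..q} (\<lambda>r. tamed_powr' \<beta> (F (X 0 \<omega>) (with_rho \<theta> r)) * pd [e_rho] (F (X 0 \<omega>)) (with_rho \<theta> r))"
    and "r \<in> {p..q} \<Longrightarrow> ((\<lambda>r. tamed_powr \<beta> (F (X 0 \<omega>) (with_rho \<theta> r))) has_real_derivative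
          tamed_powr' \<beta> (F (X 0 \<omega>) (with_rho \<theta> r)) * pd [e_rho] (F (X 0 \<omega>)) (with_rho \<theta> r)) (at r)"
    and "r \<in> {p..q} \<Longrightarrow>
        \<bar>tamed_powr' \<beta> (F (X 0 \<omega>) (with_rho \<theta> r)) * pd [e_rho] (F (X 0 \<omega>)) (with_rho \<theta> r)\<bar> \<le> K \<theta>0 r \<omega>"
proof -
  note diff = diff_upto_2D[OF F]
  have cS: "continuous_on S (F (X 0 \<omega>))" "continuous_on S (pd [e_rho] (F (X 0 \<omega>)))"
    using diff by (auto intro: continuous_on_of_differentiable_at)
  have sub: "with_rho \<theta> ` {p..q} \<subseteq> S" using box[OF \<theta>] by (rule image_subsetI)
  note comp = continuous_on_compose2[OF _ continuous_on_with_rho(2) sub]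
  show "continuous_on {p..q} (\<lambda>r. tamed_powr' \<beta> (F (X 0 \<omega>) (with_rho \<theta> r)) * pd [e_rho] (F (X 0 \<omega>)) (with_rho \<theta> r))"
    by (intro continuous_on_mult continuous_on_compose2[OF continuous_tamed_powr'] comp cS) auto
  assume r: "r \<in> {p..q}"
  show "((\<lambda>r. tamed_powr \<beta> (F (X 0 \<omega>) (with_rho \<theta> r))) has_real_derivative
          tamed_powr' \<beta> (F (X 0 \<omega>) (with_rho \<theta> r)) * pd [e_rho] (F (X 0 \<omega>)) (with_rho \<theta> r)) (at r)"
    by (rule DERIV_chain2[OF tamed_powr_has_derivative has_real_derivative_pd_rho]) (rule diff(1)[OF box[OF \<theta> r]])
  define x where "x = with_rho \<theta>0 r"
  define v where "v = with_rho (\<theta> - \<theta>0) 0"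
  have seg: "x + s *\<^sub>R v = with_rho (\<theta>0 + s *\<^sub>R (\<theta> - \<theta>0)) r" for s
    by (simp add: x_def v_def with_rho_add)
  have xv: "x + v = with_rho \<theta> r" using seg[of 1] by simp
  have norm_\<theta>: "norm (\<theta> - \<theta>0) < d" using \<theta> by (simp add: dist_norm norm_minus_commute)
  have segS: "x + s *\<^sub>R v \<in> S" if "0 \<le> s" "s \<le> 1" for s
  proof -
    have "s * norm (\<theta> - \<theta>0) \<le> 1 * norm (\<theta> - \<theta>0)" using that by (intro mult_right_mono) auto
    then have "\<theta>0 + s *\<^sub>R (\<theta> - \<theta>0) \<in> ball \<theta>0 d" using norm_\<theta> that by (simp add: dist_norm)
    then show ?thesis unfolding seg by (rule box) (rule r)
  qed
  have MN_r: "\<bar>pd [i] (\<lambda>th. F (X 0 \<omega>) th powr (1 + \<beta>) * Urho f (fst (X 0 \<omega>)) (snd (X 0 \<omega>)) th) (x + s *\<^sub>R v)\<bar> \<le> M (X 0 \<omega>) r \<and>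
      \<bar>pd [i] (\<lambda>th. F (X 0 \<omega>) th powr \<beta> * Urho f (fst (X 0 \<omega>)) (snd (X 0 \<omega>)) th) (x + s *\<^sub>R v)\<bar> \<le> N (X 0 \<omega>) r"
    if "0 \<le> s" "s \<le> 1" "i \<in> Basis - {e_rho}" for s i
    using MN[OF segS[OF that(1,2)], of i "X 0 \<omega>"] that(3) by (simp add: theta_dirs_def seg)
  \<comment> \<open>The bounds in any one marginal direction show that \<open>M\<close> and
    \<open>N\<close> are nonnegative.\<close>
  note MN_0 = MN_r[OF order_refl zero_le_one theta_dirs_nonempty[unfolded theta_dirs_def]]
  have MN_nn: "0 \<le> M (X 0 \<omega>) r" "0 \<le> N (X 0 \<omega>) r"
    by (rule order_trans[OF abs_ge_zero conjunct1[OF MN_0]], rule order_trans[OF abs_ge_zero conjunct2[OF MN_0]])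
  show "\<bar>tamed_powr' \<beta> (F (X 0 \<omega>) (with_rho \<theta> r)) * pd [e_rho] (F (X 0 \<omega>)) (with_rho \<theta> r)\<bar> \<le> K \<theta>0 r \<omega>"
  proof (cases "F (X 0 \<omega>) (x + v) \<ge> 1")
    case False
    then have "tamed_powr' \<beta> (F (X 0 \<omega>) (with_rho \<theta> r)) = 0" by (simp add: tamed_powr'_def xv)
    moreover have "0 \<le> K \<theta>0 r \<omega>" using MN_nn g beta by (simp add: K_def)
    ultimately show ?thesis by simp
  next
    case True
    \<comment> \<open>\<open>DIM(fpar)\<close> is 5, the factor written out in
      \<open>K\<close>.\<close>
    have le: "F (X 0 \<omega>) (x + v) powr (\<beta> - 1) * \<bar>pd [e_rho] (F (X 0 \<omega>)) (x + v)\<bar>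
      \<le> (if F (X 0 \<omega>) x > 0 then F (X 0 \<omega>) x powr (\<beta> - 1) * \<bar>pd [e_rho] (F (X 0 \<omega>)) x\<bar> else 0)
        + DIM(fpar) * (M (X 0 \<omega>) r + N (X 0 \<omega>) r)"
    proof (rule score_bound_on_segment[OF open_S segS _ _ beta(1) F_nonneg diff _ MN_r MN_nn True])
      show "norm v \<le> 1" using norm_\<theta> d by (simp add: v_def norm_with_rho_0)
      show "v \<bullet> e_rho = 0" by (simp add: v_def with_rho_inner_e_rho)
      show "Urho f (fst (X 0 \<omega>)) (snd (X 0 \<omega>)) y = pd [e_rho] (F (X 0 \<omega>)) y / F (X 0 \<omega>) y"
        if "y \<in> S" "F (X 0 \<omega>) y > 0" for y using that by (intro Urho_eq diff(1))
    qed
    have le1: "\<bar>tamed_powr' \<beta> (F (X 0 \<omega>) (x + v)) * pd [e_rho] (F (X 0 \<omega>)) (x + v)\<bar>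
        \<le> F (X 0 \<omega>) (x + v) powr (\<beta> - 1) * \<bar>pd [e_rho] (F (X 0 \<omega>)) (x + v)\<bar>"
      using tamed_powr'_bound[OF beta, of "F (X 0 \<omega>) (x + v)"] True
      by (simp add: abs_mult mult_right_mono)
    have le2: "(if F (X 0 \<omega>) x > 0 then F (X 0 \<omega>) x powr (\<beta> - 1) * \<bar>pd [e_rho] (F (X 0 \<omega>)) x\<bar> else 0)
      \<le> \<bar>pd [e_rho] (\<lambda>th. F (X 0 \<omega>) th powr \<beta> * g (X 0 \<omega>)) x\<bar> / (\<beta> * g (X 0 \<omega>))"
    proof (cases "F (X 0 \<omega>) x > 0")
      case True
      moreover have "F (X 0 \<omega>) differentiable (at x)" using segS[of 0] diff(1) by simp
      ultimately show ?thesis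
        using pd_weighted_powr[of "X 0 \<omega>" \<theta>0 r] beta g by (simp add: x_def[symmetric] abs_mult)
    qed (use beta g in simp)
    have "\<bar>tamed_powr' \<beta> (F (X 0 \<omega>) (x + v)) * pd [e_rho] (F (X 0 \<omega>)) (x + v)\<bar> \<le> K \<theta>0 r \<omega>"
      using order_trans[OF le1 order_trans[OF le add_right_mono[OF le2]]]
      unfolding K_def x_def[symmetric] by simp
    then show ?thesis unfolding xv .
  qed
qed

end

text \<open>At the interior minimum \<open>deriv h\<close> vanishes, so a positive second derivative
  at that single point already fixes the sign of \<open>deriv h\<close> on either side
  nearby.\<close>

lemma strict_local_min_monotone:
  fixes h :: "real \<Rightarrow> real"
  assumes d: "d > 0" and diff: "\<And>r. \<bar>r - r0\<bar> < d \<Longrightarrow> h differentiable (at r)"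
    and diff2: "deriv h differentiable (at r0)" and pos: "deriv (deriv h) r0 > 0"
    and lmin: "\<And>r. \<bar>r - r0\<bar> < d \<Longrightarrow> h r0 \<le> h r"
  obtains \<eta> where "\<eta> > 0" "\<And>r s. r0 < r \<Longrightarrow> r < s \<Longrightarrow> s < r0 + \<eta> \<Longrightarrow> h r < h s"
    "\<And>r s. r0 - \<eta> < r \<Longrightarrow> r < s \<Longrightarrow> s < r0 \<Longrightarrow> h s < h r"
proof -
  have der: "(h has_real_derivative deriv h r) (at r)" if "\<bar>r - r0\<bar> < d" for r
    using diff[OF that] by (auto simp: real_differentiable_def DERIV_imp_deriv)
  have "deriv h r0 = 0"
    by (rule DERIV_local_min[OF der d]) (use d lmin in \<open>auto simp: abs_minus_commute\<close>)
  have der2: "(deriv h has_real_derivative deriv (deriv h) r0) (at r0)"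
    using diff2 by (auto simp: real_differentiable_def DERIV_imp_deriv)
  obtain d1 where d1: "d1 > 0" "\<And>x. 0 < x \<Longrightarrow> x < d1 \<Longrightarrow> deriv h r0 < deriv h (r0 + x)"
    using DERIV_pos_inc_right[OF der2 pos] by blast
  obtain d2 where d2: "d2 > 0" "\<And>x. 0 < x \<Longrightarrow> x < d2 \<Longrightarrow> deriv h (r0 - x) < deriv h r0"
    using DERIV_pos_inc_left[OF der2 pos] by blast
  define \<eta> where "\<eta> = min d (min d1 d2)"
  show thesis
  proof (rule that[of \<eta>])
    show "\<eta> > 0" using d d1 d2 by (simp add: \<eta>_def)
    show "h r < h s" if rs: "r0 < r" "r < s" "s < r0 + \<eta>" for r s
    proof (rule DERIV_pos_imp_increasing[OF rs(2)])
      fix x assume x: "r \<le> x" "x \<le> s"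
      have "0 < deriv h x" using d1(2)[of "x - r0"] rs x \<open>deriv h r0 = 0\<close> by (simp add: \<eta>_def)
      moreover have "\<bar>x - r0\<bar> < d" using x rs by (simp add: \<eta>_def)
      ultimately show "\<exists>y. (h has_real_derivative y) (at x) \<and> 0 < y" using der by blast
    qed
    show "h s < h r" if rs: "r0 - \<eta> < r" "r < s" "s < r0" for r s
    proof (rule DERIV_neg_imp_decreasing[OF rs(2)])
      fix x assume x: "r \<le> x" "x \<le> s"
      have "deriv h x < 0" using d2(2)[of "r0 - x"] rs x \<open>deriv h r0 = 0\<close> by (simp add: \<eta>_def)
      moreover have "\<bar>x - r0\<bar> < d" using x rs by (simp add: \<eta>_def)
      ultimately show "\<exists>y. (h has_real_derivative y) (at x) \<and> y < 0" using der by blast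
    qed
  qed
qed

section \<open>Convergence of increments and critical points of the empirical objective\<close>

context dpd_sample
begin

abbreviation Hhat :: "nat \<Rightarrow> 'a \<Rightarrow> mpar \<times> mpar \<Rightarrow> real \<Rightarrow> real" where
  "Hhat n \<omega> \<theta> \<equiv> Hn \<beta> f (\<lambda>i. X i \<omega>) n (fst \<theta>) (snd \<theta>)"

text \<open>For parameters in \<open>S\<close> this is the expectation of \<open>V\<close>; written
  through \<open>I\<close> and \<open>J\<close> it inherits their differentiability from
  (A2).\<close>

definition Hlim :: "mpar \<times> mpar \<Rightarrow> real \<Rightarrow> real" where
  "Hlim \<theta> r = I (with_rho \<theta> r) - (1 + 1 / \<beta>) * J (with_rho \<theta> r)"

lemma Hhat_eq:
  assumes "n > 0"
  shows "Hhat n \<omega> \<theta> r = I (with_rho \<theta> r)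
    - (1 + 1 / \<beta>) * ((\<Sum>i<n. F (X i \<omega>) (with_rho \<theta> r) powr \<beta>) / n)"
proof -
  have "Hhat n \<omega> \<theta> r = (\<Sum>i<n. I (with_rho \<theta> r) - (1 + 1 / \<beta>) * F (X i \<omega>) (with_rho \<theta> r) powr \<beta>) / n"
    by (simp add: Hn_def V_def upar_def)
  also have "\<dots> = I (with_rho \<theta> r) - (1 + 1 / \<beta>) * ((\<Sum>i<n. F (X i \<omega>) (with_rho \<theta> r) powr \<beta>) / n)"
    using assms by (simp add: sum_subtractf sum_distrib_left[symmetric] diff_divide_distrib)
  finally show ?thesis .
qed

lemma J_eq_expectation:
  assumes "th \<in> S"
  shows "integrable P (\<lambda>\<omega>. F (X 0 \<omega>) th powr \<beta>)" "expectation (\<lambda>\<omega>. F (X 0 \<omega>) th powr \<beta>) = J th"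
proof -
  have [measurable]: "(\<lambda>u. F u th) \<in> borel_measurable borel" by (rule f_meas[OF assms])
  have "integrable lborel (\<lambda>u. g u * F u th powr \<beta>)"
    using J_int[of "[]" th] assms by (simp add: mult.commute)
  then show "integrable P (\<lambda>\<omega>. F (X 0 \<omega>) th powr \<beta>)"
    using distributed_integrable[OF distX[of 0], of "\<lambda>u. F u th powr \<beta>"] g_nonneg by simp
  show "expectation (\<lambda>\<omega>. F (X 0 \<omega>) th powr \<beta>) = J th"
    using distributed_integral[OF distX[of 0], of "\<lambda>u. F u th powr \<beta>"] g_nonneg
    by (simp add: mult.commute)
qed

text \<open>The random part of an increment of \<open>Hhat\<close> is a sample mean of increments of
  \<open>f powr \<beta>\<close>, dominated by way of the tamed power, so the uniform weak law
  applies. The interval is fixed before the tolerance \<open>e\<close>, which can therefore later be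
  the gap of \<open>Hlim\<close> across that same interval.\<close>

lemma increments_converge:
  assumes pq: "p < q" and d: "0 < d" "d \<le> 1"
    and box: "\<And>\<theta> r. \<theta> \<in> ball \<theta>0 d \<Longrightarrow> r \<in> {p..q} \<Longrightarrow> with_rho \<theta> r \<in> S"
  obtains a b where "p < a" "a < b" "b < q"
    "\<And>e. e > 0 \<Longrightarrow> \<exists>\<delta>>0. \<exists>E. (\<forall>n. E n \<in> events) \<and> (\<lambda>n. prob (E n)) \<longlonglongrightarrow> 1 \<and>
      (\<forall>n \<omega> \<theta>. n > 0 \<longrightarrow> \<omega> \<in> E n \<longrightarrow> dist \<theta> \<theta>0 < \<delta> \<longrightarrow>
        \<bar>(Hhat n \<omega> \<theta> b - Hhat n \<omega> \<theta> a) - (Hlim \<theta>0 b - Hlim \<theta>0 a)\<bar> < e)"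
proof -
  let ?v = "\<lambda>\<theta> \<omega> r. tamed_powr \<beta> (F (X 0 \<omega>) (with_rho \<theta> r))"
  let ?h = "\<lambda>\<theta> \<omega> r. tamed_powr' \<beta> (F (X 0 \<omega>) (with_rho \<theta> r)) * pd [e_rho] (F (X 0 \<omega>)) (with_rho \<theta> r)"
  have \<theta>0: "\<theta>0 \<in> ball \<theta>0 d" using d by simp
  have "AE \<omega> in P. \<forall>\<theta>\<in>ball \<theta>0 d. continuous_on {p..q} (?h \<theta> \<omega>) \<and>
      (\<forall>r\<in>{p..q}. (?v \<theta> \<omega> has_real_derivative ?h \<theta> \<omega> r) (at r) \<and> \<bar>?h \<theta> \<omega> r\<bar> \<le> K \<theta>0 r \<omega>)"
    using AE_X[OF smooth, of 0] AE_g_pos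
  proof eventually_elim
    case (elim \<omega>)
    show ?case using tamed_increment_bound[OF d box elim] by (intro ballI conjI)
  qed
  moreover have "integrable P (K \<theta>0 r)" if "r \<in> {p..q}" for r
    by (rule K_integrable) (rule box[OF \<theta>0 that])
  ultimately obtain a b D where ab: "p < a" "a < b" "b < q" and D: "integrable P D"
    and dom: "AE \<omega> in P. \<forall>\<theta>\<in>ball \<theta>0 d. \<bar>?v \<theta> \<omega> b - ?v \<theta> \<omega> a\<bar> \<le> D \<omega>"
    using increments_dominated[OF pq, of "K \<theta>0" "ball \<theta>0 d" ?h ?v] \<theta>0 by blast
  have ab_pq: "a \<in> {p..q}" "b \<in> {p..q}" using ab by auto
  have inS: "with_rho \<theta> a \<in> S" "with_rho \<theta> b \<in> S" if "\<theta> \<in> ball \<theta>0 d" for \<theta>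
    using box that ab_pq by auto
  define \<Delta> where "\<Delta> = (\<lambda>\<theta> u. F u (with_rho \<theta> b) powr \<beta> - F u (with_rho \<theta> a) powr \<beta>)"
  have meas: "\<Delta> \<theta> \<in> borel_measurable borel" if "\<theta> \<in> ball \<theta>0 d" for \<theta>
    unfolding \<Delta>_def using f_meas inS[OF that] by measurable
  have cont: "AE \<omega> in P. continuous_on (ball \<theta>0 d) (\<lambda>\<theta>. \<Delta> \<theta> (X i \<omega>))" for i
    using AE_X[OF smooth, of i]
  proof eventually_elim
    case (elim \<omega>)
    have "continuous_on S (F (X i \<omega>))"
      by (rule continuous_on_of_differentiable_at) (rule diff_upto_2D[OF elim])
    then have "continuous_on (ball \<theta>0 d) (\<lambda>\<theta>. F (X i \<omega>) (with_rho \<theta> r))" if "r \<in> {a, b}" for r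
      by (rule continuous_on_compose2[OF _ continuous_on_with_rho(1)]) (use inS that in auto)
    then show ?case unfolding \<Delta>_def using F_nonneg beta
      by (intro continuous_on_diff continuous_on_powr' continuous_on_const) auto
  qed
  \<comment> \<open>Replacing the power by the tamed power costs at most 2 at each of the two end
    points.\<close>
  have dom': "AE \<omega> in P. \<forall>\<theta>\<in>ball \<theta>0 d. \<bar>\<Delta> \<theta> (X 0 \<omega>)\<bar> \<le> 4 + D \<omega>"
    using dom
  proof eventually_elim
    case (elim \<omega>)
    show ?case
    proof
      fix \<theta> assume "\<theta> \<in> ball \<theta>0 d"
      then have "\<bar>?v \<theta> \<omega> b - ?v \<theta> \<omega> a\<bar> \<le> D \<omega>" using elim by blast
      moreover have "\<bar>F (X 0 \<omega>) (with_rho \<theta> r) powr \<beta> - ?v \<theta> \<omega> r\<bar> \<le> 2" for r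
        using tamed_powr_close F_nonneg beta(1) by blast
      note this[of a] this[of b]
      ultimately show "\<bar>\<Delta> \<theta> (X 0 \<omega>)\<bar> \<le> 4 + D \<omega>" unfolding \<Delta>_def by linarith
    qed
  qed
  have E\<Delta>: "expectation (\<lambda>\<omega>. \<Delta> \<theta>0 (X 0 \<omega>)) = J (with_rho \<theta>0 b) - J (with_rho \<theta>0 a)"
    unfolding \<Delta>_def using J_eq_expectation inS[OF \<theta>0] by (simp add: Bochner_Integration.integral_diff)
  have contI: "isCont (\<lambda>\<theta>. I (with_rho \<theta> r)) \<theta>0" if "with_rho \<theta>0 r \<in> S" for r
  proof -
    have "isCont I (with_rho \<theta>0 r)"
      using diff_upto_2D(1)[OF I_diff that] by (rule differentiable_imp_continuous_within)
    moreover have "isCont (\<lambda>\<theta>. with_rho \<theta> r) \<theta>0"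
      by (rule continuous_on_interior[OF continuous_on_with_rho(1)[of UNIV]]) simp
    ultimately show ?thesis by (rule isCont_o2[rotated])
  qed
  define c where "c = 1 + 1 / \<beta>"
  have c: "c > 0" using beta by (simp add: c_def add_pos_pos)
  show thesis
  proof (rule that[OF ab])
    fix e :: real assume e: "e > 0"
    have same_distr: "distr P borel (X i) = distr P borel (X 0)" for i by (simp add: distr_X)
    have D': "integrable P (\<lambda>\<omega>. 4 + D \<omega>)" using D by simp
    \<comment> \<open>The sampling error enters the objective with factor \<open>c\<close>, so
      \<open>e / (2 * c)\<close> uses half of \<open>e\<close>; the other half goes to the
      continuity of \<open>I\<close>.\<close>
    have ec: "e / (2 * c) > 0" using e c by simp
    obtain \<delta> E where \<delta>: "\<delta> > 0" "\<delta> \<le> d" and E: "\<And>n. E n \<in> events" "(\<lambda>n. prob (E n)) \<longlonglongrightarrow> 1"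
      "\<And>n \<omega> \<theta>. n > 0 \<Longrightarrow> \<omega> \<in> E n \<Longrightarrow> dist \<theta> \<theta>0 < \<delta> \<Longrightarrow>
        \<bar>(\<Sum>i<n. \<Delta> \<theta> (X i \<omega>)) / n - expectation (\<lambda>\<omega>. \<Delta> \<theta>0 (X 0 \<omega>))\<bar> < e / (2 * c)"
    proof (rule uniform_weak_law[OF indep same_distr d(1) ec meas cont dom' D'])
      fix \<delta> E assume "\<delta> > 0" "\<delta> \<le> d" "\<And>n. E n \<in> events" "(\<lambda>n. prob (E n)) \<longlonglongrightarrow> 1"
        "\<And>n \<omega> \<theta>. n > 0 \<Longrightarrow> \<omega> \<in> E n \<Longrightarrow> dist \<theta> \<theta>0 < \<delta> \<Longrightarrow>
        \<bar>(\<Sum>i<n. \<Delta> \<theta> (X i \<omega>)) / n - expectation (\<lambda>\<omega>. \<Delta> \<theta>0 (X 0 \<omega>))\<bar> < e / (2 * c)"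
      then show thesis by (rule that)
    qed
    have "isCont (\<lambda>\<theta>. I (with_rho \<theta> b) - I (with_rho \<theta> a)) \<theta>0"
      by (intro isCont_diff contI inS \<theta>0)
    then obtain \<delta>' where \<delta>': "\<delta>' > 0" "\<And>\<theta>. dist \<theta> \<theta>0 < \<delta>' \<Longrightarrow>
        \<bar>(I (with_rho \<theta> b) - I (with_rho \<theta> a)) - (I (with_rho \<theta>0 b) - I (with_rho \<theta>0 a))\<bar> < e / 2"
      unfolding continuous_at_eps_delta dist_real_def using e by (meson half_gt_zero)
    have "\<bar>(Hhat n \<omega> \<theta> b - Hhat n \<omega> \<theta> a) - (Hlim \<theta>0 b - Hlim \<theta>0 a)\<bar> < e"
      if n: "n > 0" and \<omega>: "\<omega> \<in> E n" and \<theta>: "dist \<theta> \<theta>0 < min \<delta> \<delta>'" for n \<omega> \<theta>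
    proof -
      define m where "m = (\<Sum>i<n. \<Delta> \<theta> (X i \<omega>)) / n"
      define I' where "I' = (\<lambda>\<theta>. I (with_rho \<theta> b) - I (with_rho \<theta> a))"
      have "Hhat n \<omega> \<theta> b - Hhat n \<omega> \<theta> a = I' \<theta> - c * m"
        unfolding Hhat_eq[OF n] m_def \<Delta>_def c_def I'_def
        by (simp add: sum_subtractf diff_divide_distrib right_diff_distrib)
      moreover have "Hlim \<theta>0 b - Hlim \<theta>0 a = I' \<theta>0 - c * expectation (\<lambda>\<omega>. \<Delta> \<theta>0 (X 0 \<omega>))"
        unfolding E\<Delta> Hlim_def c_def I'_def by (simp add: algebra_simps)
      moreover have "c * \<bar>m - expectation (\<lambda>\<omega>. \<Delta> \<theta>0 (X 0 \<omega>))\<bar> < c * (e / (2 * c))"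
        using E(3)[OF n \<omega>, of \<theta>] \<theta> c unfolding m_def by (intro mult_strict_left_mono) auto
      then have "\<bar>c * m - c * expectation (\<lambda>\<omega>. \<Delta> \<theta>0 (X 0 \<omega>))\<bar> < e / 2"
        using c by (simp add: right_diff_distrib[symmetric] abs_mult)
      moreover have "\<bar>I' \<theta> - I' \<theta>0\<bar> < e / 2" using \<delta>'(2)[of \<theta>] \<theta> unfolding I'_def by simp
      ultimately show ?thesis by linarith
    qed
    then show "\<exists>\<delta>>0. \<exists>E. (\<forall>n. E n \<in> events) \<and> (\<lambda>n. prob (E n)) \<longlonglongrightarrow> 1 \<and>
      (\<forall>n \<omega> \<theta>. n > 0 \<longrightarrow> \<omega> \<in> E n \<longrightarrow> dist \<theta> \<theta>0 < \<delta> \<longrightarrow>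
        \<bar>(Hhat n \<omega> \<theta> b - Hhat n \<omega> \<theta> a) - (Hlim \<theta>0 b - Hlim \<theta>0 a)\<bar> < e)"
      using \<delta>(1) \<delta>'(1) E(1,2) by (intro exI[of _ "min \<delta> \<delta>'"] conjI exI[of _ E]) auto
  qed
qed

text \<open>The vanishing derivative is a clause of its own since \<open>Hhat\<close> may have cusps
  where some \<open>F (X i \<omega>)\<close> is 0, so that minimality alone does not express the
  estimating equation.\<close>

definition critical :: "nat \<Rightarrow> 'a \<Rightarrow> mpar \<times> mpar \<Rightarrow> real \<Rightarrow> bool" where
  "critical n \<omega> \<theta> r \<longleftrightarrow> (Hhat n \<omega> \<theta> has_real_derivative 0) (at r) \<and>
    (\<exists>\<delta>>0. \<forall>s. \<bar>s - r\<bar> < \<delta> \<longrightarrow> Hhat n \<omega> \<theta> r \<le> Hhat n \<omega> \<theta> s)"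

text \<open>The minimum over \<open>{a..b}\<close> is attained, and the lower values at
  \<open>a'\<close> and \<open>b'\<close> keep it off both ends. The cusp terms enter with a
  negative sign, so \<open>has_derivative_0_at_local_min\<close> gives a zero derivative
  there.\<close>

lemma critical_point_exists:
  assumes n: "n > 0" and F: "\<And>i. diff_upto 2 (F (X i \<omega>)) S"
    and inS: "\<And>r. r \<in> {a..b} \<Longrightarrow> with_rho \<theta> r \<in> S"
    and ab: "a < a'" "a' < b'" "b' < b"
    and Ha: "Hhat n \<omega> \<theta> a' < Hhat n \<omega> \<theta> a" and Hb: "Hhat n \<omega> \<theta> b' < Hhat n \<omega> \<theta> b"
  shows "\<exists>r. a < r \<and> r < b \<and> critical n \<omega> \<theta> r"
proof -
  have diffF: "(\<lambda>r. F (X i \<omega>) (with_rho \<theta> r)) differentiable (at r)" if "r \<in> {a..b}" for i r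
    using has_real_derivative_pd_rho[OF diff_upto_2D(1)[OF F inS[OF that]]] by (auto simp: real_differentiable_def)
  have diffI: "(\<lambda>r. I (with_rho \<theta> r)) differentiable (at r)" if "r \<in> {a..b}" for r
    using has_real_derivative_pd_rho[OF diff_upto_2D(1)[OF I_diff inS[OF that]]] by (auto simp: real_differentiable_def)
  define c where "c = (1 + 1 / \<beta>) / n"
  have H: "Hhat n \<omega> \<theta> = (\<lambda>r. I (with_rho \<theta> r) - c * (\<Sum>i<n. F (X i \<omega>) (with_rho \<theta> r) powr \<beta>))"
    by (rule ext) (simp add: Hhat_eq[OF n] c_def)
  have "continuous_on {a..b} (\<lambda>r. I (with_rho \<theta> r))"
    "\<And>i. continuous_on {a..b} (\<lambda>r. F (X i \<omega>) (with_rho \<theta> r))"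
    using diffI diffF by (auto intro: continuous_on_of_differentiable_at)
  then have "continuous_on {a..b} (Hhat n \<omega> \<theta>)"
    unfolding H using F_nonneg beta
    by (intro continuous_on_diff continuous_on_mult continuous_on_sum continuous_on_powr' continuous_on_const) auto
  then obtain r where r: "r \<in> {a..b}" "\<And>s. s \<in> {a..b} \<Longrightarrow> Hhat n \<omega> \<theta> r \<le> Hhat n \<omega> \<theta> s"
    using continuous_attains_inf[of "{a..b}" "Hhat n \<omega> \<theta>"] ab by auto
  have "r \<noteq> a" "r \<noteq> b" using r(2)[of a'] r(2)[of b'] Ha Hb ab by auto
  then have ar: "a < r" "r < b" using r(1) by auto
  define \<delta> where "\<delta> = min (r - a) (b - r)"
  have \<delta>: "\<delta> > 0" using ar by (simp add: \<delta>_def)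
  have lmin: "Hhat n \<omega> \<theta> r \<le> Hhat n \<omega> \<theta> s" if "\<bar>s - r\<bar> < \<delta>" for s
    using that by (intro r(2)) (auto simp: \<delta>_def)
  have "(Hhat n \<omega> \<theta> has_real_derivative 0) (at r)"
    unfolding H
  proof (rule has_derivative_0_at_local_min[where d=\<delta>])
    show "0 \<le> c" using beta by (simp add: c_def)
    show "I (with_rho \<theta> r) - c * (\<Sum>i<n. F (X i \<omega>) (with_rho \<theta> r) powr \<beta>)
        \<le> I (with_rho \<theta> s) - c * (\<Sum>i<n. F (X i \<omega>) (with_rho \<theta> s) powr \<beta>)" if "\<bar>s - r\<bar> < \<delta>" for s
      using lmin[OF that] unfolding H .
  qed (use diffF diffI r(1) F_nonneg \<delta> in auto)
  then show ?thesis using ar \<delta> lmin unfolding critical_def by blast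
qed

text \<open>An increment estimated with an error below the size of its limit keeps the sign of the
  limit. Doing this for one interval on each side of \<open>\<rho>0\<close> yields the drop and the
  rise between which a critical point lies.\<close>

lemma critical_points_near:
  assumes in_S: "with_rho \<theta>0 \<rho>0 \<in> S" and \<eta>: "\<eta> > 0"
    and incr: "\<And>r s. \<rho>0 < r \<Longrightarrow> r < s \<Longrightarrow> s < \<rho>0 + \<eta> \<Longrightarrow> Hlim \<theta>0 r < Hlim \<theta>0 s"
    and decr: "\<And>r s. \<rho>0 - \<eta> < r \<Longrightarrow> r < s \<Longrightarrow> s < \<rho>0 \<Longrightarrow> Hlim \<theta>0 s < Hlim \<theta>0 r"
    and \<epsilon>: "\<epsilon> > 0"
  obtains \<delta> E where "\<delta> > 0" "\<And>n. E n \<in> events" "(\<lambda>n. prob (E n)) \<longlonglongrightarrow> 1"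
    "\<And>n \<omega> \<theta>. n > 0 \<Longrightarrow> \<omega> \<in> E n \<Longrightarrow> dist \<theta> \<theta>0 < \<delta> \<Longrightarrow> \<exists>r. \<bar>r - \<rho>0\<bar> < \<epsilon> \<and> critical n \<omega> \<theta> r"
proof -
  obtain s where s: "s > 0" "ball (with_rho \<theta>0 \<rho>0) s \<subseteq> S"
    using open_S in_S open_contains_ball by blast
  \<comment> \<open>Both coordinates of the box move by less than \<open>d\<close>, so half of
    \<open>s\<close> keeps the box in the ball; the cap 1 bounds the length of the segments in the
    score estimate.\<close>
  define d where "d = min 1 (s / 2)"
  have d: "0 < d" "d \<le> 1" using s by (auto simp: d_def)
  have box: "with_rho \<theta> r \<in> S" if "\<theta> \<in> ball \<theta>0 d" "\<bar>r - \<rho>0\<bar> < d" for \<theta> r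
  proof -
    have "with_rho \<theta> r = with_rho \<theta>0 \<rho>0 + (with_rho (\<theta> - \<theta>0) 0 + (r - \<rho>0) *\<^sub>R e_rho)"
      by (simp add: with_rho_def e_rho_def prod_eq_iff)
    then have "dist (with_rho \<theta>0 \<rho>0) (with_rho \<theta> r) = norm (with_rho (\<theta> - \<theta>0) 0 + (r - \<rho>0) *\<^sub>R e_rho)"
      by (simp add: dist_norm norm_minus_commute add.commute)
    also have "\<dots> \<le> norm (\<theta> - \<theta>0) + \<bar>r - \<rho>0\<bar>"
      using norm_triangle_ineq[of "with_rho (\<theta> - \<theta>0) 0" "(r - \<rho>0) *\<^sub>R e_rho"]
      by (simp add: norm_with_rho_0 norm_Basis[OF e_rho_Basis])
    also have "\<dots> < s" using that by (simp add: d_def dist_norm norm_minus_commute)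
    finally show ?thesis using s(2) by auto
  qed
  define \<tau> where "\<tau> = min \<epsilon> (min d \<eta>)"
  have \<tau>: "\<tau> > 0" "\<tau> \<le> \<epsilon>" "\<tau> \<le> d" "\<tau> \<le> \<eta>" using \<epsilon> d \<eta> by (auto simp: \<tau>_def)
  \<comment> \<open>Starting at distance \<open>\<tau> / 4\<close> keeps the window strictly on one
    side of \<open>\<rho>0\<close>, where \<open>Hlim\<close> is monotone; ending at
    \<open>\<tau> / 2\<close> keeps it within \<open>\<epsilon>\<close>, \<open>d\<close> and
    \<open>\<eta>\<close>.\<close>
  obtain a b where ab: "\<rho>0 + \<tau> / 4 < a" "a < b" "b < \<rho>0 + \<tau> / 2"
    and conv: "\<And>e. e > 0 \<Longrightarrow> \<exists>\<delta>>0. \<exists>E. (\<forall>n. E n \<in> events) \<and> (\<lambda>n. prob (E n)) \<longlonglongrightarrow> 1 \<and>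
      (\<forall>n \<omega> \<theta>. n > 0 \<longrightarrow> \<omega> \<in> E n \<longrightarrow> dist \<theta> \<theta>0 < \<delta> \<longrightarrow>
        \<bar>(Hhat n \<omega> \<theta> b - Hhat n \<omega> \<theta> a) - (Hlim \<theta>0 b - Hlim \<theta>0 a)\<bar> < e)"
    by (rule increments_converge[of "\<rho>0 + \<tau> / 4" "\<rho>0 + \<tau> / 2" d \<theta>0, OF _ d box]) (use \<tau> in auto)
  obtain a' b' where ab': "\<rho>0 - \<tau> / 2 < a'" "a' < b'" "b' < \<rho>0 - \<tau> / 4"
    and conv': "\<And>e. e > 0 \<Longrightarrow> \<exists>\<delta>>0. \<exists>E. (\<forall>n. E n \<in> events) \<and> (\<lambda>n. prob (E n)) \<longlonglongrightarrow> 1 \<and>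
      (\<forall>n \<omega> \<theta>. n > 0 \<longrightarrow> \<omega> \<in> E n \<longrightarrow> dist \<theta> \<theta>0 < \<delta> \<longrightarrow>
        \<bar>(Hhat n \<omega> \<theta> b' - Hhat n \<omega> \<theta> a') - (Hlim \<theta>0 b' - Hlim \<theta>0 a')\<bar> < e)"
    by (rule increments_converge[of "\<rho>0 - \<tau> / 2" "\<rho>0 - \<tau> / 4" d \<theta>0, OF _ d box]) (use \<tau> in auto)
  have gap: "Hlim \<theta>0 b - Hlim \<theta>0 a > 0" "Hlim \<theta>0 a' - Hlim \<theta>0 b' > 0"
    using incr[of a b] decr[of a' b'] ab ab' \<tau> by auto
  obtain \<delta>1 E1 where E1: "\<delta>1 > 0" "\<And>n. E1 n \<in> events" "(\<lambda>n. prob (E1 n)) \<longlonglongrightarrow> 1"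
    "\<And>n \<omega> \<theta>. n > 0 \<Longrightarrow> \<omega> \<in> E1 n \<Longrightarrow> dist \<theta> \<theta>0 < \<delta>1 \<Longrightarrow>
        \<bar>(Hhat n \<omega> \<theta> b - Hhat n \<omega> \<theta> a) - (Hlim \<theta>0 b - Hlim \<theta>0 a)\<bar> < Hlim \<theta>0 b - Hlim \<theta>0 a"
    using conv[OF gap(1)] by blast
  obtain \<delta>2 E2 where E2: "\<delta>2 > 0" "\<And>n. E2 n \<in> events" "(\<lambda>n. prob (E2 n)) \<longlonglongrightarrow> 1"
    "\<And>n \<omega> \<theta>. n > 0 \<Longrightarrow> \<omega> \<in> E2 n \<Longrightarrow> dist \<theta> \<theta>0 < \<delta>2 \<Longrightarrow>
        \<bar>(Hhat n \<omega> \<theta> b' - Hhat n \<omega> \<theta> a') - (Hlim \<theta>0 b' - Hlim \<theta>0 a')\<bar> < Hlim \<theta>0 a' - Hlim \<theta>0 b'"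
    using conv'[OF gap(2)] by blast
  have "AE \<omega> in P. \<forall>i. diff_upto 2 (F (X i \<omega>)) S"
    using AE_X[OF smooth] by (simp add: AE_all_countable)
  then obtain G where G: "G \<subseteq> {\<omega>\<in>space P. \<forall>i. diff_upto 2 (F (X i \<omega>)) S}" "G \<in> events" "prob G = 1"
    by (rule AE_E_prob)
  show thesis
  proof (rule that[of "min d (min \<delta>1 \<delta>2)" "\<lambda>n. G \<inter> (E1 n \<inter> E2 n)"])
    show "(\<lambda>n. prob (G \<inter> (E1 n \<inter> E2 n))) \<longlonglongrightarrow> 1"
      using G E1 E2 by (intro prob_tendsto_1_Int sets.Int) auto
    fix n \<omega> \<theta> assume n: "n > (0::nat)" and \<omega>: "\<omega> \<in> G \<inter> (E1 n \<inter> E2 n)"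
      and \<theta>: "dist \<theta> \<theta>0 < min d (min \<delta>1 \<delta>2)"
    have "\<exists>r. a' < r \<and> r < b \<and> critical n \<omega> \<theta> r"
    \<comment> \<open>The outer points \<open>a'\<close> and \<open>b\<close> are the ends of the
      search interval; the inner points \<open>b'\<close> and \<open>a\<close> supply the lower
      values.\<close>
    proof (rule critical_point_exists[OF n, of \<omega> a' b \<theta> b' a])
      show "diff_upto 2 (F (X i \<omega>)) S" for i using G(1) \<omega> by blast
      show "with_rho \<theta> r \<in> S" if "r \<in> {a'..b}" for r
        using that \<theta> ab ab' \<tau> by (intro box) (auto simp: dist_commute abs_less_iff)
      show "Hhat n \<omega> \<theta> b' < Hhat n \<omega> \<theta> a'" using E2(4)[OF n, of \<omega> \<theta>] \<omega> \<theta> by auto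
      show "Hhat n \<omega> \<theta> a < Hhat n \<omega> \<theta> b" using E1(4)[OF n, of \<omega> \<theta>] \<omega> \<theta> by auto
    qed (use ab ab' \<tau> in auto)
    then obtain r where r: "a' < r" "r < b" "critical n \<omega> \<theta> r" by blast
    have "\<bar>r - \<rho>0\<bar> < \<epsilon>" using r ab ab' \<tau> by (auto simp: abs_less_iff)
    then show "\<exists>r. \<bar>r - \<rho>0\<bar> < \<epsilon> \<and> critical n \<omega> \<theta> r" using r(3) by blast
  qed (use d E1 E2 G in auto)
qed

end

section \<open>Convergence in probability and the choice of a root\<close>

lemma (in prob_space) conv_prob_imp_prob_tendsto_1:
  fixes Y :: "nat \<Rightarrow> 'a \<Rightarrow> 'b::{metric_space, second_countable_topology}"
  assumes conv: "conv_prob M Y c" and [measurable]: "\<And>n. Y n \<in> borel_measurable M" and d: "d > 0"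
  shows "(\<lambda>n. prob {\<omega>\<in>space M. dist (Y n \<omega>) c < d}) \<longlonglongrightarrow> 1"
proof (rule LIMSEQ_I)
  fix e :: real assume e: "e > 0"
  have "\<forall>\<^sub>F n in sequentially. \<exists>A\<in>events. {\<omega>\<in>space M. d / 2 < dist (Y n \<omega>) c} \<subseteq> A \<and> prob A < e"
    using conv d e unfolding conv_prob_def by (meson half_gt_zero)
  then obtain n0 where n0: "\<And>n. n \<ge> n0 \<Longrightarrow>
      \<exists>A\<in>events. {\<omega>\<in>space M. d / 2 < dist (Y n \<omega>) c} \<subseteq> A \<and> prob A < e"
    by (auto simp: eventually_sequentially)
  show "\<exists>n0. \<forall>n\<ge>n0. norm (prob {\<omega>\<in>space M. dist (Y n \<omega>) c < d} - 1) < e"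
  proof (intro exI allI impI)
    fix n assume "n \<ge> n0"
    then obtain A where A: "A \<in> events" "{\<omega>\<in>space M. d / 2 < dist (Y n \<omega>) c} \<subseteq> A" "prob A < e"
      using n0 by blast
    \<comment> \<open>\<open>conv_prob\<close> controls strict exceedance only, so it is used at
      \<open>d / 2\<close> to obtain a distance strictly below \<open>d\<close>.\<close>
    have "space M - A \<subseteq> {\<omega>\<in>space M. dist (Y n \<omega>) c < d}" using A(2) d by force
    then have "prob (space M - A) \<le> prob {\<omega>\<in>space M. dist (Y n \<omega>) c < d}"
      by (rule finite_measure_mono) measurable
    then have "1 - prob A \<le> prob {\<omega>\<in>space M. dist (Y n \<omega>) c < d}"
      using prob_compl[OF A(1)] by simp
    moreover have "prob {\<omega>\<in>space M. dist (Y n \<omega>) c < d} \<le> 1" by simp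
    ultimately show "norm (prob {\<omega>\<in>space M. dist (Y n \<omega>) c < d} - 1) < e" using A(3) by simp
  qed
qed

text \<open>Choosing a root nearly as close to \<open>\<rho>0\<close> as possible makes a single sequence work for every
  \<open>\<epsilon>\<close>, without a diagonal argument.\<close>
lemma (in prob_space) consistent_selection:
  fixes R :: "nat \<Rightarrow> 'a \<Rightarrow> real \<Rightarrow> bool"
  assumes near: "\<And>\<epsilon>. \<epsilon> > 0 \<Longrightarrow> \<exists>E. (\<forall>n. E n \<in> events) \<and> (\<lambda>n. prob (E n)) \<longlonglongrightarrow> 1 \<and>
      (\<forall>n \<omega>. n > 0 \<longrightarrow> \<omega> \<in> E n \<longrightarrow> (\<exists>r. \<bar>r - \<rho>0\<bar> < \<epsilon> \<and> R n \<omega> r))"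
  obtains \<rho>hat A where "\<And>n. A n \<in> events" "(\<lambda>n. prob (A n)) \<longlonglongrightarrow> 1"
    "\<And>n \<omega>. \<omega> \<in> A n \<Longrightarrow> R n \<omega> (\<rho>hat n \<omega>)" "conv_prob M \<rho>hat \<rho>0"
proof -
  \<comment> \<open>The smallest distance of a root to \<open>\<rho>0\<close> need not be attained;
    the slack \<open>1 / Suc n\<close> makes a choice possible and vanishes in the limit.\<close>
  define \<rho>hat where "\<rho>hat = (\<lambda>n \<omega>. SOME r. R n \<omega> r \<and> (\<forall>s. R n \<omega> s \<longrightarrow> \<bar>r - \<rho>0\<bar> \<le> \<bar>s - \<rho>0\<bar> + 1 / Suc n))"
  have sel: "R n \<omega> (\<rho>hat n \<omega>)" "\<bar>\<rho>hat n \<omega> - \<rho>0\<bar> \<le> \<bar>s - \<rho>0\<bar> + 1 / Suc n" if s: "R n \<omega> s" for n \<omega> s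
  proof -
    define D where "D = (\<lambda>r. \<bar>r - \<rho>0\<bar>) ` Collect (R n \<omega>)"
    have D: "D \<noteq> {}" "bdd_below D" using s by (auto simp: D_def intro!: bdd_belowI[of _ 0])
    have "Inf D < Inf D + 1 / Suc n" by simp
    then obtain y where y: "y \<in> D" "y < Inf D + 1 / Suc n"
      using cInf_less_iff[OF D] by blast
    then obtain r where r: "R n \<omega> r" "y = \<bar>r - \<rho>0\<bar>" by (auto simp: D_def)
    have "\<bar>r - \<rho>0\<bar> \<le> \<bar>t - \<rho>0\<bar> + 1 / Suc n" if "R n \<omega> t" for t
    proof -
      have "Inf D \<le> \<bar>t - \<rho>0\<bar>" using that D(2) by (intro cInf_lower) (auto simp: D_def)
      then show ?thesis using y(2) r(2) by linarith
    qed
    then have "\<exists>r. R n \<omega> r \<and> (\<forall>s. R n \<omega> s \<longrightarrow> \<bar>r - \<rho>0\<bar> \<le> \<bar>s - \<rho>0\<bar> + 1 / Suc n)"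
      using r(1) by blast
    from someI_ex[OF this] s show "R n \<omega> (\<rho>hat n \<omega>)" "\<bar>\<rho>hat n \<omega> - \<rho>0\<bar> \<le> \<bar>s - \<rho>0\<bar> + 1 / Suc n"
      unfolding \<rho>hat_def by blast+
  qed
  obtain E1 where E1: "\<forall>n. E1 n \<in> events" "(\<lambda>n. prob (E1 n)) \<longlonglongrightarrow> 1"
    "\<forall>n \<omega>. n > 0 \<longrightarrow> \<omega> \<in> E1 n \<longrightarrow> (\<exists>r. \<bar>r - \<rho>0\<bar> < 1 \<and> R n \<omega> r)"
    using near[OF zero_less_one] by (elim exE conjE) (rule that)
  show thesis
  \<comment> \<open>At \<open>n = 0\<close> no root is provided, so the event is emptied there,
    which leaves the limit unchanged.\<close>
  proof (rule that[of "\<lambda>n. if n = 0 then {} else E1 n" \<rho>hat])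
    show "(if n = 0 then {} else E1 n) \<in> events" for n using E1(1) by simp
    show "(\<lambda>n. prob (if n = 0 then {} else E1 n)) \<longlonglongrightarrow> 1"
      by (rule Lim_transform_eventually[OF E1(2)]) (rule eventually_sequentiallyI[of 1], simp)
    show "R n \<omega> (\<rho>hat n \<omega>)" if "\<omega> \<in> (if n = 0 then {} else E1 n)" for n \<omega>
    proof -
      have "n > 0" "\<omega> \<in> E1 n" using that by (auto split: if_splits)
      then obtain r where "R n \<omega> r" using E1(3) by blast
      then show ?thesis by (rule sel(1))
    qed
    show "conv_prob M \<rho>hat \<rho>0"
      unfolding conv_prob_def
    proof (intro allI impI)
      fix \<epsilon> \<delta> :: real assume \<epsilon>: "\<epsilon> > 0" and \<delta>: "\<delta> > 0"
      obtain E where E: "\<forall>n. E n \<in> events" "(\<lambda>n. prob (E n)) \<longlonglongrightarrow> 1"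
        "\<forall>n \<omega>. n > 0 \<longrightarrow> \<omega> \<in> E n \<longrightarrow> (\<exists>r. \<bar>r - \<rho>0\<bar> < \<epsilon> / 2 \<and> R n \<omega> r)"
        using near[OF half_gt_zero[OF \<epsilon>]] by (elim exE conjE) (rule that)
      have "(\<lambda>n. 1 / real (Suc n)) \<longlonglongrightarrow> 0" using LIMSEQ_inverse_real_of_nat by (simp add: inverse_eq_divide)
      then have "\<forall>\<^sub>F n in sequentially. 1 / real (Suc n) < \<epsilon> / 2"
        using \<epsilon> by (intro order_tendstoD(2)) auto
      moreover have "\<forall>\<^sub>F n in sequentially. 1 - \<delta> < prob (E n)"
        using E(2) \<delta> by (intro order_tendstoD(1)) auto
      ultimately show "\<forall>\<^sub>F n in sequentially. \<exists>A\<in>events. {\<omega>\<in>space M. \<epsilon> < dist (\<rho>hat n \<omega>) \<rho>0} \<subseteq> A \<and> prob A < \<delta>"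
        using eventually_gt_at_top[of 0]
      proof eventually_elim
        case (elim n)
        have "dist (\<rho>hat n \<omega>) \<rho>0 \<le> \<epsilon>" if \<omega>: "\<omega> \<in> E n" for \<omega>
        proof -
          obtain r where "\<bar>r - \<rho>0\<bar> < \<epsilon> / 2" "R n \<omega> r" using E(3) elim(3) \<omega> by blast
          then show ?thesis using sel(2)[of n \<omega> r] elim(1) unfolding dist_real_def by linarith
        qed
        \<comment> \<open>The selection is not known to be measurable; as outer probability
          requires, its bad set is covered by the event \<open>space M - E n\<close>.\<close>
        then have "{\<omega>\<in>space M. \<epsilon> < dist (\<rho>hat n \<omega>) \<rho>0} \<subseteq> space M - E n" by force
        moreover have "prob (space M - E n) < \<delta>" using prob_compl[of "E n"] E(1) elim(2) by simp
        ultimately show ?case using E(1) by (intro bexI[of _ "space M - E n"] conjI sets.compl_sets) auto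
      qed
    qed
  qed
qed

section \<open>Consistency\<close>

theorem theorem1:
  fixes P :: "'a measure"
    and X :: "nat \<Rightarrow> 'a \<Rightarrow> real \<times> real"
    and g :: "real \<times> real \<Rightarrow> real" and g1 g2 :: "real \<Rightarrow> real"
    and f :: "real \<Rightarrow> real \<Rightarrow> mpar \<Rightarrow> mpar \<Rightarrow> real \<Rightarrow> real"
    and f1 f2 :: "real \<Rightarrow> mpar \<Rightarrow> real"
    and \<beta> :: real
    and \<gamma>0 :: "fpar set"
    and \<theta>g1 \<theta>g2 :: mpar and \<rho>g :: real
    and \<theta>hat1 \<theta>hat2 :: "nat \<Rightarrow> 'a \<Rightarrow> mpar"
  assumes P: "prob_space P"
  \<comment> \<open>i.i.d. sample with joint density g and marginal densities g1, g2\<close>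
    and indep: "prob_space.indep_vars P (\<lambda>_. borel) X UNIV"
    and g_nonneg: "\<And>u. 0 \<le> g u" and g1_nonneg: "\<And>x. 0 \<le> g1 x" and g2_nonneg: "\<And>x. 0 \<le> g2 x"
    and distX: "\<And>i. distributed P lborel (X i) (\<lambda>u. ennreal (g u))"
    and distX1: "\<And>i. distributed P lborel (\<lambda>\<omega>. fst (X i \<omega>)) (\<lambda>x. ennreal (g1 x))"
    and distX2: "\<And>i. distributed P lborel (\<lambda>\<omega>. snd (X i \<omega>)) (\<lambda>x. ennreal (g2 x))"
  \<comment> \<open>the model: bivariate densities f with univariate marginals f1, f2\<close>
    and f_nonneg: "\<And>x1 x2 t1 t2 r. 0 \<le> f x1 x2 t1 t2 r"
    and f1_nonneg: "\<And>x t. 0 \<le> f1 x t" and f2_nonneg: "\<And>x t. 0 \<le> f2 x t"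
    and f_dens: "\<And>t1 t2 r. (t1, t2, r) \<in> PS \<Longrightarrow>
        integrable lborel (\<lambda>u. f (fst u) (snd u) t1 t2 r) \<and>
        (LINT u|lborel. f (fst u) (snd u) t1 t2 r) = 1"
    and f1_marg: "\<And>t1 t2 r x1. (t1, t2, r) \<in> PS \<Longrightarrow> f1 x1 t1 = (LINT x2|lborel. f x1 x2 t1 t2 r)"
    and f2_marg: "\<And>t1 t2 r x2. (t1, t2, r) \<in> PS \<Longrightarrow> f2 x2 t2 = (LINT x1|lborel. f x1 x2 t1 t2 r)"
  \<comment> \<open>tuning parameter\<close>
    and beta: "0 < \<beta>" "\<beta> \<le> 1"
  \<comment> \<open>(A1)\<close>
    and \<gamma>0: "open \<gamma>0" "\<gamma>0 \<subseteq> PS"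
    and A1: "AE u in lborel.
        C_upto 4 (\<lambda>th. f1 (fst u) (fst th)) \<gamma>0 \<and>
        C_upto 4 (\<lambda>th. f2 (snd u) (fst (snd th))) \<gamma>0 \<and>
        C_upto 4 (upar f (fst u) (snd u)) \<gamma>0"
  \<comment> \<open>(A2)\<close>
    and A2: "diff_under_int 4 (\<lambda>x th. f1 x (fst th) powr (1 + \<beta>)) lborel \<gamma>0"
            "diff_under_int 4 (\<lambda>x th. f2 x (fst (snd th)) powr (1 + \<beta>)) lborel \<gamma>0"
            "diff_under_int 4 (\<lambda>u th. upar f (fst u) (snd u) th powr (1 + \<beta>)) lborel \<gamma>0"
            "diff_under_int 4 (\<lambda>x th. f1 x (fst th) powr \<beta> * g1 x) lborel \<gamma>0"
            "diff_under_int 4 (\<lambda>x th. f2 x (fst (snd th)) powr \<beta> * g2 x) lborel \<gamma>0"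
            "diff_under_int 4 (\<lambda>u th. upar f (fst u) (snd u) th powr \<beta> * g u) lborel \<gamma>0"
  \<comment> \<open>(A3)\<close>
    and A3_1: "\<And>a b c. {a, b, c} \<subseteq> (Basis :: mpar set) \<Longrightarrow> \<exists>M.
        integrable P (\<lambda>\<omega>. M (fst (X 0 \<omega>))) \<and>
        (\<forall>t\<in>PSm. \<forall>x. \<bar>pd [a, b, c] (Vj \<beta> f1 x) t\<bar> < M x)"
    and A3_2: "\<And>a b c. {a, b, c} \<subseteq> (Basis :: mpar set) \<Longrightarrow> \<exists>M.
        integrable P (\<lambda>\<omega>. M (snd (X 0 \<omega>))) \<and>
        (\<forall>t\<in>PSm. \<forall>x. \<bar>pd [a, b, c] (Vj \<beta> f2 x) t\<bar> < M x)"
  \<comment> \<open>(A4)\<close>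
    and A4: "\<exists>M12 N12 :: real \<Rightarrow> real \<Rightarrow> real \<Rightarrow> real.
        (\<forall>r. integrable P (\<lambda>\<omega>. M12 (fst (X 0 \<omega>)) (snd (X 0 \<omega>)) r) \<and>
             integrable lborel (\<lambda>u. M12 (fst u) (snd u) r) \<and>
             integrable P (\<lambda>\<omega>. N12 (fst (X 0 \<omega>)) (snd (X 0 \<omega>)) r)) \<and>
        (\<forall>t1 t2 r x1 x2 e. (\<exists>r'. (t1, t2, r') \<in> \<gamma>0) \<and> r \<in> {-1..1} \<and> e \<in> theta_dirs \<longrightarrow>
           \<bar>pd [e] (\<lambda>th. upar f x1 x2 th powr (1 + \<beta>) * Urho f x1 x2 th) (t1, t2, r)\<bar> < M12 x1 x2 r \<and>
           \<bar>pd [e] (\<lambda>th. upar f x1 x2 th powr \<beta> * Urho f x1 x2 th) (t1, t2, r)\<bar> < N12 x1 x2 r)"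
  \<comment> \<open>(A5)\<close>
    and A5: "\<exists>v1 v2 :: real \<Rightarrow> real \<Rightarrow> mpar \<Rightarrow> mpar \<Rightarrow> real.
        (\<forall>t1 t2. integrable P (\<lambda>\<omega>. v1 (fst (X 0 \<omega>)) (snd (X 0 \<omega>)) t1 t2) \<and>
                 integrable P (\<lambda>\<omega>. v2 (fst (X 0 \<omega>)) (snd (X 0 \<omega>)) t1 t2)) \<and>
        (\<forall>t1 t2 r x1 x2 e. (\<exists>r'. (t1, t2, r') \<in> \<gamma>0) \<and> r \<in> {-1..1} \<and> e \<in> theta_dirs \<longrightarrow>
           \<bar>pd [e_rho, e_rho, e_rho] (upar (V \<beta> f) x1 x2) (t1, t2, r)\<bar> < v1 x1 x2 t1 t2 \<and>
           \<bar>pd [e_rho, e_rho, e_rho, e] (upar (V \<beta> f) x1 x2) (t1, t2, r)\<bar> < v2 x1 x2 t1 t2)"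
  \<comment> \<open>best fitting parameters: theta^g_j minimises H_j, rho^g minimises H(theta^g_1, theta^g_2, .)\<close>
    and thg1: "\<theta>g1 \<in> PSm" "\<And>t. t \<in> PSm \<Longrightarrow>
        (LINT \<omega>|P. Vj \<beta> f1 (fst (X 0 \<omega>)) \<theta>g1) \<le> (LINT \<omega>|P. Vj \<beta> f1 (fst (X 0 \<omega>)) t)"
    and thg2: "\<theta>g2 \<in> PSm" "\<And>t. t \<in> PSm \<Longrightarrow>
        (LINT \<omega>|P. Vj \<beta> f2 (snd (X 0 \<omega>)) \<theta>g2) \<le> (LINT \<omega>|P. Vj \<beta> f2 (snd (X 0 \<omega>)) t)"
    and rhog: "\<And>r. r \<in> {-1..1} \<Longrightarrow>
        (LINT \<omega>|P. V \<beta> f (fst (X 0 \<omega>)) (snd (X 0 \<omega>)) \<theta>g1 \<theta>g2 \<rho>g)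
        \<le> (LINT \<omega>|P. V \<beta> f (fst (X 0 \<omega>)) (snd (X 0 \<omega>)) \<theta>g1 \<theta>g2 r)"
    and thg_in: "(\<theta>g1, \<theta>g2, \<rho>g) \<in> \<gamma>0"
    and rhog_int: "-1 < \<rho>g" "\<rho>g < 1"
    and second: "deriv (\<lambda>s. deriv (\<lambda>r. LINT \<omega>|P. V \<beta> f (fst (X 0 \<omega>)) (snd (X 0 \<omega>)) \<theta>g1 \<theta>g2 r) s) \<rho>g > 0"
  \<comment> \<open>marginal minimum DPD estimators, consistent\<close>
    and est1: "\<And>n \<omega>. \<omega> \<in> space P \<Longrightarrow> \<theta>hat1 n \<omega> \<in> PSm \<and>
        (\<forall>t\<in>PSm. Hjn \<beta> f1 (\<lambda>i. fst (X i \<omega>)) n (\<theta>hat1 n \<omega>) \<le> Hjn \<beta> f1 (\<lambda>i. fst (X i \<omega>)) n t)"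
    and est2: "\<And>n \<omega>. \<omega> \<in> space P \<Longrightarrow> \<theta>hat2 n \<omega> \<in> PSm \<and>
        (\<forall>t\<in>PSm. Hjn \<beta> f2 (\<lambda>i. snd (X i \<omega>)) n (\<theta>hat2 n \<omega>) \<le> Hjn \<beta> f2 (\<lambda>i. snd (X i \<omega>)) n t)"
    and meas1: "\<And>n. \<theta>hat1 n \<in> borel_measurable P"
    and meas2: "\<And>n. \<theta>hat2 n \<in> borel_measurable P"
    and cons1: "conv_prob P \<theta>hat1 \<theta>g1"
    and cons2: "conv_prob P \<theta>hat2 \<theta>g2"
  shows "\<exists>(\<rho>hat :: nat \<Rightarrow> 'a \<Rightarrow> real) (A :: nat \<Rightarrow> 'a set).
           (\<forall>n. A n \<in> sets P) \<and>
           (\<lambda>n. measure P (A n)) \<longlonglongrightarrow> 1 \<and>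
           (\<forall>n. \<forall>\<omega>\<in>A n. \<rho>hat n \<omega> \<in> {-1..1} \<and>
              ((\<lambda>r. Hn \<beta> f (\<lambda>i. X i \<omega>) n (\<theta>hat1 n \<omega>) (\<theta>hat2 n \<omega>) r)
                 has_real_derivative 0) (at (\<rho>hat n \<omega>)) \<and>
              (\<exists>\<delta>>0. \<forall>r\<in>{-1..1}. \<bar>r - \<rho>hat n \<omega>\<bar> < \<delta> \<longrightarrow>
                 Hn \<beta> f (\<lambda>i. X i \<omega>) n (\<theta>hat1 n \<omega>) (\<theta>hat2 n \<omega>) (\<rho>hat n \<omega>)
                 \<le> Hn \<beta> f (\<lambda>i. X i \<omega>) n (\<theta>hat1 n \<omega>) (\<theta>hat2 n \<omega>) r)) \<and>
           conv_prob P \<rho>hat \<rho>g"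
proof -
  interpret prob_space P by (rule P)
  obtain M12 N12 where MN12:
    "\<And>r. integrable P (\<lambda>\<omega>. M12 (fst (X 0 \<omega>)) (snd (X 0 \<omega>)) r)"
    "\<And>r. integrable P (\<lambda>\<omega>. N12 (fst (X 0 \<omega>)) (snd (X 0 \<omega>)) r)"
    "\<And>t1 t2 r x1 x2 e. \<exists>r'. (t1, t2, r') \<in> \<gamma>0 \<Longrightarrow> r \<in> {-1..1} \<Longrightarrow> e \<in> theta_dirs \<Longrightarrow>
       \<bar>pd [e] (\<lambda>th. upar f x1 x2 th powr (1 + \<beta>) * Urho f x1 x2 th) (t1, t2, r)\<bar> < M12 x1 x2 r \<and>
       \<bar>pd [e] (\<lambda>th. upar f x1 x2 th powr \<beta> * Urho f x1 x2 th) (t1, t2, r)\<bar> < N12 x1 x2 r"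
    using A4 by (elim exE conjE) blast
  interpret dpd_sample P X g f \<beta> \<gamma>0 "\<lambda>u. M12 (fst u) (snd u)" "\<lambda>u. N12 (fst u) (snd u)"
  proof unfold_locales
    show "(\<lambda>u. upar f (fst u) (snd u) th) \<in> borel_measurable borel" if "th \<in> \<gamma>0" for th
    proof -
      have "(fst th, fst (snd th), snd (snd th)) \<in> PS" using \<gamma>0(2) that by auto
      from f_dens[OF this] have "integrable lborel (\<lambda>u. upar f (fst u) (snd u) th)" by (simp add: upar_def)
      then show ?thesis using borel_measurable_integrable by fastforce
    qed
    show "AE u in lborel. diff_upto 2 (upar f (fst u) (snd u)) \<gamma>0"
      using A1 by eventually_elim (auto simp: C_upto_def diff_upto_def)
    show "diff_upto 2 (\<lambda>th. LINT u|lborel. upar f (fst u) (snd u) th powr (1 + \<beta>)) \<gamma>0"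
      using A2(3) by (auto simp: diff_under_int_def diff_upto_def)
    show "diff_upto 2 (\<lambda>th. LINT u|lborel. upar f (fst u) (snd u) th powr \<beta> * g u) \<gamma>0"
      using A2(6) by (auto simp: diff_under_int_def diff_upto_def)
    show "integrable lborel (\<lambda>u. pd is (\<lambda>th. upar f (fst u) (snd u) th powr \<beta> * g u) th)"
      if "set is \<subseteq> Basis" "length is \<le> 1" "th \<in> \<gamma>0" for "is" th
      using A2(6) that unfolding diff_under_int_def by (meson le_trans one_le_numeral)
    show "\<bar>pd [e] (\<lambda>th. upar f (fst u) (snd u) th powr (1 + \<beta>) * Urho f (fst u) (snd u) th) th\<bar>
          \<le> M12 (fst u) (snd u) (snd (snd th)) \<and>
        \<bar>pd [e] (\<lambda>th. upar f (fst u) (snd u) th powr \<beta> * Urho f (fst u) (snd u) th) th\<bar>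
          \<le> N12 (fst u) (snd u) (snd (snd th))"
      if th: "th \<in> \<gamma>0" and e: "e \<in> theta_dirs" for u th e
    proof -
      have "snd (snd th) \<in> {-1..1}" using \<gamma>0(2) th by (auto simp: PS_def)
      \<comment> \<open>(A4) lets \<rho> range over \<open>{-1..1}\<close> above any marginal pair
        that occurs in \<open>\<gamma>0\<close>; a point of \<open>\<gamma>0\<close> is its own
        witness for that.\<close>
      moreover have "\<exists>r'. (fst th, fst (snd th), r') \<in> \<gamma>0" using th by (intro exI[of _ "snd (snd th)"]) simp
      ultimately show ?thesis
        using MN12(3)[of "fst th" "fst (snd th)" "snd (snd th)" e "fst u" "snd u"] e by (simp add: less_imp_le)
    qed
  qed (use assms MN12 in auto)

  define \<theta>0 where "\<theta>0 = (\<theta>g1, \<theta>g2)"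
  define H where "H = (\<lambda>r. LINT \<omega>|P. V \<beta> f (fst (X 0 \<omega>)) (snd (X 0 \<omega>)) \<theta>g1 \<theta>g2 r)"
  have in_\<gamma>0: "with_rho \<theta>0 \<rho>g \<in> \<gamma>0" using thg_in by (simp add: \<theta>0_def with_rho_def)
  have H_eq: "H r = Hlim \<theta>0 r" if "with_rho \<theta>0 r \<in> \<gamma>0" for r
  proof -
    have "H r = (LINT \<omega>|P. I (with_rho \<theta>0 r) - (1 + 1 / \<beta>) * F (X 0 \<omega>) (with_rho \<theta>0 r) powr \<beta>)"
      by (simp add: H_def V_def upar_def with_rho_def \<theta>0_def)
    then show ?thesis using J_eq_expectation[OF that] by (simp add: Hlim_def prob_space)
  qed
  define U where "U = with_rho \<theta>0 -` \<gamma>0"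
  have U: "open U" "\<rho>g \<in> U"
    using open_vimage[OF \<gamma>0(1) continuous_on_with_rho(2)] in_\<gamma>0 by (auto simp: U_def)
  then obtain d0 where d0: "d0 > 0" "\<And>r. \<bar>r - \<rho>g\<bar> < d0 \<Longrightarrow> r \<in> U"
    unfolding open_dist dist_real_def by blast
  \<comment> \<open>\<open>H\<close> is tied to \<open>I\<close> and \<open>J\<close> only for
    parameters in \<open>\<gamma>0\<close>, so its derivative is identified with \<open>H'\<close>
    on the open slice \<open>U\<close>; agreement on a neighbourhood is what gives access to the
    second derivative at \<open>\<rho>g\<close>.\<close>
  define H' where "H' = (\<lambda>r. pd [e_rho] I (with_rho \<theta>0 r) - (1 + 1 / \<beta>) * pd [e_rho] J (with_rho \<theta>0 r))"
  have H_der: "(H has_real_derivative H' r) (at r)" if "r \<in> U" for r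
  proof (rule has_field_derivative_transform_within_open[OF _ U(1) that])
    have r: "with_rho \<theta>0 r \<in> \<gamma>0" using that by (simp add: U_def)
    show "(Hlim \<theta>0 has_real_derivative H' r) (at r)"
      unfolding Hlim_def[abs_def] H'_def
      by (intro DERIV_diff DERIV_cmult has_real_derivative_pd_rho diff_upto_2D[OF I_diff r] diff_upto_2D[OF J_diff r])
    show "Hlim \<theta>0 s = H s" if "s \<in> U" for s using H_eq[of s] that by (simp add: U_def)
  qed
  have "deriv H differentiable (at \<rho>g)"
  proof -
    have "H' differentiable (at \<rho>g)"
      unfolding H'_def using has_real_derivative_pd_rho[OF diff_upto_2D(2)[OF I_diff in_\<gamma>0]]
        has_real_derivative_pd_rho[OF diff_upto_2D(2)[OF J_diff in_\<gamma>0]]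
      by (intro differentiable_diff differentiable_mult differentiable_const) (auto simp: real_differentiable_def)
    then obtain D where "(H' has_real_derivative D) (at \<rho>g)" by (auto simp: real_differentiable_def)
    then have "(deriv H has_real_derivative D) (at \<rho>g)"
      by (rule has_field_derivative_transform_within_open[OF _ U]) (use H_der DERIV_imp_deriv in metis)
    then show ?thesis by (auto simp: real_differentiable_def)
  qed
  \<comment> \<open>Within \<open>d1\<close> the minimality of \<open>\<rho>g\<close> over
    \<open>{-1..1}\<close> can be used, and roots that close lie in \<open>{-1..1}\<close>.\<close>
  define d1 where "d1 = min d0 (min (1 - \<rho>g) (1 + \<rho>g))"
  have d1: "d1 > 0" "d1 \<le> d0" "\<And>r. \<bar>r - \<rho>g\<bar> < d1 \<Longrightarrow> r \<in> {-1..1}"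
    using d0(1) rhog_int by (auto simp: d1_def)
  obtain \<eta>0 where \<eta>0: "\<eta>0 > 0" "\<And>r s. \<rho>g < r \<Longrightarrow> r < s \<Longrightarrow> s < \<rho>g + \<eta>0 \<Longrightarrow> H r < H s"
    "\<And>r s. \<rho>g - \<eta>0 < r \<Longrightarrow> r < s \<Longrightarrow> s < \<rho>g \<Longrightarrow> H s < H r"
  proof (rule strict_local_min_monotone[OF d1(1) _ \<open>deriv H differentiable (at \<rho>g)\<close>])
    show "H differentiable (at r)" if "\<bar>r - \<rho>g\<bar> < d1" for r
      using H_der[of r] d0(2)[of r] d1(2) that by (auto simp: real_differentiable_def)
    show "deriv (deriv H) \<rho>g > 0" using second by (simp add: H_def)
    show "H \<rho>g \<le> H r" if "\<bar>r - \<rho>g\<bar> < d1" for r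
      using rhog[OF d1(3)[OF that]] by (simp add: H_def)
    fix \<eta> assume "\<eta> > 0" "\<And>r s. \<rho>g < r \<Longrightarrow> r < s \<Longrightarrow> s < \<rho>g + \<eta> \<Longrightarrow> H r < H s"
      "\<And>r s. \<rho>g - \<eta> < r \<Longrightarrow> r < s \<Longrightarrow> s < \<rho>g \<Longrightarrow> H s < H r"
    then show thesis by (rule that)
  qed
  define \<eta> where "\<eta> = min \<eta>0 d0"
  have \<eta>: "\<eta> > 0" using \<eta>0(1) d0(1) by (simp add: \<eta>_def)
  have Hlim: "Hlim \<theta>0 r = H r" if "\<bar>r - \<rho>g\<bar> < \<eta>" for r
    using H_eq[of r] d0(2)[of r] that by (simp add: U_def \<eta>_def)
  have incr: "Hlim \<theta>0 r < Hlim \<theta>0 s" if "\<rho>g < r" "r < s" "s < \<rho>g + \<eta>" for r s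
  proof -
    have "\<bar>r - \<rho>g\<bar> < \<eta>" "\<bar>s - \<rho>g\<bar> < \<eta>" "s < \<rho>g + \<eta>0" using that by (auto simp: \<eta>_def)
    then show ?thesis using \<eta>0(2)[of r s] that by (simp add: Hlim)
  qed
  have decr: "Hlim \<theta>0 s < Hlim \<theta>0 r" if "\<rho>g - \<eta> < r" "r < s" "s < \<rho>g" for r s
  proof -
    have "\<bar>r - \<rho>g\<bar> < \<eta>" "\<bar>s - \<rho>g\<bar> < \<eta>" "\<rho>g - \<eta>0 < r" using that by (auto simp: \<eta>_def)
    then show ?thesis using \<eta>0(3)[of r s] that by (simp add: Hlim)
  qed

  define R where "R = (\<lambda>n \<omega> r. r \<in> {-1..1} \<and> critical n \<omega> (\<theta>hat1 n \<omega>, \<theta>hat2 n \<omega>) r)"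
  have near: "\<exists>E. (\<forall>n. E n \<in> events) \<and> (\<lambda>n. prob (E n)) \<longlonglongrightarrow> 1 \<and>
      (\<forall>n \<omega>. n > 0 \<longrightarrow> \<omega> \<in> E n \<longrightarrow> (\<exists>r. \<bar>r - \<rho>g\<bar> < \<epsilon> \<and> R n \<omega> r))" if \<epsilon>: "\<epsilon> > 0" for \<epsilon>
  proof -
    have "min \<epsilon> d1 > 0" using \<epsilon> d1(1) by simp
    obtain \<delta> E where \<delta>: "\<delta> > 0" and E: "\<And>n. E n \<in> events" "(\<lambda>n. prob (E n)) \<longlonglongrightarrow> 1"
      "\<And>n \<omega> \<theta>. n > 0 \<Longrightarrow> \<omega> \<in> E n \<Longrightarrow> dist \<theta> \<theta>0 < \<delta> \<Longrightarrow> \<exists>r. \<bar>r - \<rho>g\<bar> < min \<epsilon> d1 \<and> critical n \<omega> \<theta> r"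
    proof (rule critical_points_near[OF in_\<gamma>0 \<eta> incr decr \<open>min \<epsilon> d1 > 0\<close>])
      fix \<delta> E assume "\<delta> > 0" "\<And>n. E n \<in> events" "(\<lambda>n. prob (E n)) \<longlonglongrightarrow> 1"
        "\<And>n \<omega> \<theta>. n > 0 \<Longrightarrow> \<omega> \<in> E n \<Longrightarrow> dist \<theta> \<theta>0 < \<delta> \<Longrightarrow> \<exists>r. \<bar>r - \<rho>g\<bar> < min \<epsilon> d1 \<and> critical n \<omega> \<theta> r"
      then show thesis by (rule that)
    qed
    have \<delta>2: "\<delta> / 2 > 0" using \<delta> by simp
    \<comment> \<open>A distance in the product is at most the sum of the coordinate distances, so
      \<open>\<delta> / 2\<close> for each marginal estimator suffices.\<close>
    define T1 where "T1 = (\<lambda>n. {\<omega>\<in>space P. dist (\<theta>hat1 n \<omega>) \<theta>g1 < \<delta> / 2})"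
    define T2 where "T2 = (\<lambda>n. {\<omega>\<in>space P. dist (\<theta>hat2 n \<omega>) \<theta>g2 < \<delta> / 2})"
    have T: "T1 n \<in> events" "T2 n \<in> events" for n
      using meas1[measurable] meas2[measurable] unfolding T1_def T2_def by measurable
    have T_lim: "(\<lambda>n. prob (T1 n)) \<longlonglongrightarrow> 1" "(\<lambda>n. prob (T2 n)) \<longlonglongrightarrow> 1"
      unfolding T1_def T2_def
      by (rule conv_prob_imp_prob_tendsto_1[OF cons1 meas1 \<delta>2], rule conv_prob_imp_prob_tendsto_1[OF cons2 meas2 \<delta>2])
    have "\<exists>r. \<bar>r - \<rho>g\<bar> < \<epsilon> \<and> R n \<omega> r" if n: "n > 0" and \<omega>: "\<omega> \<in> E n \<inter> (T1 n \<inter> T2 n)" for n \<omega>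
    proof -
      have "dist (\<theta>hat1 n \<omega>, \<theta>hat2 n \<omega>) \<theta>0 \<le> dist (\<theta>hat1 n \<omega>) \<theta>g1 + dist (\<theta>hat2 n \<omega>) \<theta>g2"
        unfolding \<theta>0_def dist_Pair_Pair by (rule sqrt_sum_squares_le_sum) auto
      also have "\<dots> < \<delta>" using \<omega> by (auto simp: T1_def T2_def)
      finally obtain r where "\<bar>r - \<rho>g\<bar> < min \<epsilon> d1" "critical n \<omega> (\<theta>hat1 n \<omega>, \<theta>hat2 n \<omega>) r"
        using E(3)[OF n, of \<omega>] \<omega> by blast
      then show ?thesis using d1(3)[of r] by (auto simp: R_def)
    qed
    moreover have "(\<lambda>n. prob (E n \<inter> (T1 n \<inter> T2 n))) \<longlonglongrightarrow> 1"
      using E T T_lim by (intro prob_tendsto_1_Int sets.Int) auto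
    ultimately show ?thesis
      using E(1) T by (intro exI[of _ "\<lambda>n. E n \<inter> (T1 n \<inter> T2 n)"]) auto
  qed
  obtain \<rho>hat A where A: "\<And>n. A n \<in> events" "(\<lambda>n. prob (A n)) \<longlonglongrightarrow> 1"
    "\<And>n \<omega>. \<omega> \<in> A n \<Longrightarrow> R n \<omega> (\<rho>hat n \<omega>)" "conv_prob P \<rho>hat \<rho>g"
  proof (rule consistent_selection[OF near])
    fix \<rho>hat A assume "\<And>n. A n \<in> events" "(\<lambda>n. prob (A n)) \<longlonglongrightarrow> 1"
      "\<And>n \<omega>. \<omega> \<in> A n \<Longrightarrow> R n \<omega> (\<rho>hat n \<omega>)" "conv_prob P \<rho>hat \<rho>g"
    then show thesis by (rule that)
  qed
  have "(Hhat n \<omega> (\<theta>hat1 n \<omega>, \<theta>hat2 n \<omega>) has_real_derivative 0) (at (\<rho>hat n \<omega>))"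
    "\<exists>\<delta>>0. \<forall>r\<in>{-1..1}. \<bar>r - \<rho>hat n \<omega>\<bar> < \<delta> \<longrightarrow>
      Hhat n \<omega> (\<theta>hat1 n \<omega>, \<theta>hat2 n \<omega>) (\<rho>hat n \<omega>) \<le> Hhat n \<omega> (\<theta>hat1 n \<omega>, \<theta>hat2 n \<omega>) r"
    "\<rho>hat n \<omega> \<in> {-1..1}" if "\<omega> \<in> A n" for n \<omega>
    using A(3)[OF that] unfolding R_def critical_def by blast+
  then show ?thesis
    using A(1,2,4) by (intro exI[of _ \<rho>hat] exI[of _ A] conjI allI ballI) simp_all
qed

end
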